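(* Let $(E_1,E_2,\Phi)$ be a holomorphic triple of vortex type on a compact Riemann surface $(X,\omega)$, let $\sigma>0$, suppose that the central charge $Z$ of the triple satisfies $\operatorname{Im}Z>0$, let $\hat\theta=\operatorname{Arg}Z\in(0,\pi)$, and suppose $\cos(\hat\theta)\le0$. Let $h_1,h_2$ be Hermitian metrics on $E_1,E_2$. Then $(h_1,h_2)$ solves the deformed vortex equations together with the calibration constraint if and only if the following hold: (i) $\cos(\hat\theta)+\frac{2\pi}{\sigma}\sin(\hat\theta)>0$; (ii) $E_1$ has rank $1$ and $\Phi\in H^0(X,\mathrm{Hom}(E_2,E_1))$ is nowhere vanishing (in particular $E_2\simeq E_1$); and (iii) $$i\Lambda F_1=i\Lambda F_2=\frac{\sin(\hat\theta)-\frac{2\pi}{\sigma}\cos(\hat\theta)}{\cos(\hat\theta)+\frac{2\pi}{\sigma}\sin(\hat\theta)}\quad\text{and}\quad |\Phi|^2\equiv\frac{2\pi}{\sigma}.$$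
   Context: $X$ is connected with Kähler form $\omega$ and associated metric $g$; $V_X=\int_X\omega$. A holomorphic triple of vortex type is $(E_1,E_2,\Phi)$ with $E_1,E_2\to X$ holomorphic vector bundles, $\operatorname{rk}E_2=1$, and $\Phi\in H^0(X,\mathrm{Hom}(E_2,E_1))$. Its central charge is $$Z=\frac{\sigma}{2\pi}\left(\left[\frac{V_X}{2\pi}(\operatorname{rk}E_1+1)-\frac{4\pi}{\sigma}\deg E_2\right]+i\left[\deg E_1+\deg E_2+\frac{2V_X}{\sigma}\right]\right).$$ Notation: $F_i$ is the curvature of the Chern connection of $h_i$, $\Lambda$ is contraction with $\omega$ (so $\frac{1}{2\pi}\int_X\operatorname{Tr}(i\Lambda F_i)\,\omega=\deg E_i$); $\nabla$ is the $(1,0)$ part of the Chern connection on $\mathrm{Hom}(E_2,E_1)$ with metric $h=h_1h_2^{-1}$; $\dagger$ and $|\cdot|$ are taken with respect to $h_1,h_2,g$; $\nabla\Phi(\nabla\Phi)^\dagger:=g^{p\bar j}\nabla_p\Phi(\nabla_j\Phi)^\dagger\in\operatorname{End}(E_1)$; $\{A,B\}=AB+BA$. Deformed vortex equations: $$\cos\hat\theta\,(i\Lambda F_1+\Phi\Phi^\dagger)=\sin\hat\theta\left(I_{E_1}-\tfrac12\{i\Lambda F_1,\Phi\Phi^\dagger\}+\tfrac12\nabla\Phi(\nabla\Phi)^\dagger\right),$$ $$\cos\hat\theta\left(i\Lambda F_2+\tfrac{4\pi}{\sigma}-|\Phi|^2\right)=\sin\hat\theta\left(1+\left(|\Phi|^2-\tfrac{4\pi}{\sigma}\right)i\Lambda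 F_2+\tfrac12|\nabla\Phi|^2\right).$$ Calibration constraint: $$\cos\hat\theta\left(I_{E_1}-\tfrac12\{i\Lambda F_1,\Phi\Phi^\dagger\}+\tfrac12\nabla\Phi(\nabla\Phi)^\dagger\right)+\sin\hat\theta\,(i\Lambda F_1+\Phi\Phi^\dagger)>0,$$ $$\cos\hat\theta\left(1+\left(|\Phi|^2-\tfrac{4\pi}{\sigma}\right)i\Lambda F_2+\tfrac12|\nabla\Phi|^2\right)+\sin\hat\theta\left(i\Lambda F_2+\tfrac{4\pi}{\sigma}-|\Phi|^2\right)>0.$$ *)

theory Defs
  imports "HOL-Analysis.Analysis" "HOL-Complex_Analysis.Complex_Analysis"
begin

primrec Ck_on :: "nat \<Rightarrow> ('b::real_normed_vector \<Rightarrow> 'c::real_normed_vector) \<Rightarrow> 'b set \<Rightarrow> bool" where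
  "Ck_on 0 f S \<longleftrightarrow> continuous_on S f"
| "Ck_on (Suc k) f S \<longleftrightarrow>
     (\<forall>x\<in>S. f differentiable (at x)) \<and> (\<forall>v. Ck_on k (\<lambda>x. frechet_derivative f (at x) v) S)"

definition smooth_on :: "('b::real_normed_vector \<Rightarrow> 'c::real_normed_vector) \<Rightarrow> 'b set \<Rightarrow> bool" where
  "smooth_on f S \<longleftrightarrow> (\<forall>k. Ck_on k f S)"

definition hdot :: "complex ^ 'n \<Rightarrow> complex ^ 'n \<Rightarrow> complex" where
  "hdot v w = (\<Sum>i\<in>UNIV. v $ i * cnj (w $ i))"

definition ctranspose :: "complex ^ 'n ^ 'm \<Rightarrow> complex ^ 'm ^ 'n" where
  "ctranspose M = (\<chi> i j. cnj (M $ j $ i))"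

definition positive_definite :: "complex ^ 'n ^ 'n \<Rightarrow> bool" where
  "positive_definite M \<longleftrightarrow> ctranspose M = M \<and> (\<forall>v. v \<noteq> 0 \<longrightarrow> 0 < Re (hdot (M *v v) v))"

definition anticomm :: "complex ^ 'n ^ 'n \<Rightarrow> complex ^ 'n ^ 'n \<Rightarrow> complex ^ 'n ^ 'n" where
  "anticomm A B = A ** B + B ** A"

text \<open>The surface is the type \<open>'a\<close> with its topology; a chart is a pair of its domain and the
  coordinate function, of which only the values on the domain matter.\<close>

type_synonym 'a chart = "'a set \<times> ('a \<Rightarrow> complex)"

abbreviation chart_inv :: "'a chart \<Rightarrow> complex \<Rightarrow> 'a" where
  "chart_inv c \<equiv> inv_into (fst c) (snd c)"

definition riemann_surface :: "('a::t2_space) chart set \<Rightarrow> bool" where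
  "riemann_surface \<A> \<longleftrightarrow>
     (\<Union>c\<in>\<A>. fst c) = UNIV \<and>
     (\<forall>c\<in>\<A>. open (fst c) \<and> open (snd c ` fst c) \<and>
        homeomorphism (fst c) (snd c ` fst c) (snd c) (chart_inv c)) \<and>
     (\<forall>c\<in>\<A>. \<forall>c'\<in>\<A>. (snd c' \<circ> chart_inv c) holomorphic_on snd c ` (fst c \<inter> fst c'))"

definition smooth_on_surface ::
    "('a::t2_space) chart set \<Rightarrow> ('a \<Rightarrow> 'c::real_normed_vector) \<Rightarrow> 'a set \<Rightarrow> bool" where
  "smooth_on_surface \<A> f V \<longleftrightarrow>
     (\<forall>c\<in>\<A>. smooth_on (f \<circ> chart_inv c) (snd c ` (fst c \<inter> V)))"

definition hol_on_surface :: "('a::t2_space) chart set \<Rightarrow> ('a \<Rightarrow> complex) \<Rightarrow> 'a set \<Rightarrow> bool" where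
  "hol_on_surface \<A> f V \<longleftrightarrow>
     (\<forall>c\<in>\<A>. (f \<circ> chart_inv c) holomorphic_on snd c ` (fst c \<inter> V))"

definition hol_matrix_on_surface ::
    "('a::t2_space) chart set \<Rightarrow> ('a \<Rightarrow> complex ^ 'n ^ 'm) \<Rightarrow> 'a set \<Rightarrow> bool" where
  "hol_matrix_on_surface \<A> M V \<longleftrightarrow> (\<forall>i j. hol_on_surface \<A> (\<lambda>x. M x $ i $ j) V)"

text \<open>Wirtinger derivatives \<open>\<partial>/\<partial>z\<close> and \<open>\<partial>/\<partial>\<close>z-bar with respect to the coordinate \<open>z\<close> of a chart.\<close>

definition d_z :: "'a chart \<Rightarrow> ('a \<Rightarrow> complex) \<Rightarrow> 'a \<Rightarrow> complex" where
  "d_z c f x =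
     (let D = frechet_derivative (f \<circ> chart_inv c) (at (snd c x)) in (D 1 - \<i> * D \<i>) / 2)"

definition d_zbar :: "'a chart \<Rightarrow> ('a \<Rightarrow> complex) \<Rightarrow> 'a \<Rightarrow> complex" where
  "d_zbar c f x =
     (let D = frechet_derivative (f \<circ> chart_inv c) (at (snd c x)) in (D 1 + \<i> * D \<i>) / 2)"

definition mat_d_z :: "'a chart \<Rightarrow> ('a \<Rightarrow> complex ^ 'n ^ 'm) \<Rightarrow> 'a \<Rightarrow> complex ^ 'n ^ 'm" where
  "mat_d_z c M x = (\<chi> i j. d_z c (\<lambda>y. M y $ i $ j) x)"

definition mat_d_zbar :: "'a chart \<Rightarrow> ('a \<Rightarrow> complex ^ 'n ^ 'm) \<Rightarrow> 'a \<Rightarrow> complex ^ 'n ^ 'm" where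
  "mat_d_zbar c M x = (\<chi> i j. d_zbar c (\<lambda>y. M y $ i $ j) x)"

text \<open>A Kaehler form is given by its coefficients: in the chart \<open>c\<close> with coordinate \<open>z\<close> it is
  \<open>\<omega> = i g\<^sub>c dz \<and> dz-bar = 2 g\<^sub>c dx \<and> dy\<close>, and \<open>g\<^sub>c\<close> is the component of the associated metric that is
  inverted in contractions. Closedness is automatic in complex dimension one.\<close>

definition kaehler_form :: "('a::t2_space) chart set \<Rightarrow> ('a chart \<Rightarrow> 'a \<Rightarrow> real) \<Rightarrow> bool" where
  "kaehler_form \<A> g \<longleftrightarrow>
     (\<forall>c\<in>\<A>. smooth_on (g c \<circ> chart_inv c) (snd c ` fst c) \<and> (\<forall>x\<in>fst c. 0 < g c x)) \<and>
     (\<forall>c\<in>\<A>. \<forall>c'\<in>\<A>. \<forall>x\<in>fst c \<inter> fst c'.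
        g c x = g c' x * (cmod (deriv (snd c' \<circ> chart_inv c) (snd c x)))\<^sup>2)"

text \<open>The Borel measure on the surface whose integral is integration against \<open>\<omega>\<close>.\<close>

definition area_measure :: "('a::t2_space) chart set \<Rightarrow> ('a chart \<Rightarrow> 'a \<Rightarrow> real) \<Rightarrow> 'a measure" where
  "area_measure \<A> g = (THE \<mu>. sets \<mu> = sets borel \<and>
     (\<forall>c\<in>\<A>. \<forall>B\<in>sets borel. B \<subseteq> fst c \<longrightarrow>
        emeasure \<mu> B =
          (\<integral>\<^sup>+ z. ennreal (2 * g c (chart_inv c z)) * indicator (snd c ` B) z \<partial>lborel)))"

definition volume :: "('a::t2_space) chart set \<Rightarrow> ('a chart \<Rightarrow> 'a \<Rightarrow> real) \<Rightarrow> real" where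
  "volume \<A> g = measure (area_measure \<A> g) UNIV"

text \<open>A bundle with total space \<open>'e\<close> and typical fibre \<open>complex ^ 'n\<close> is given by its projection and a
  bundle atlas of local trivialisations (domain in the base, fibre coordinates). The linear structure
  of the fibres and the topology and complex structure of the total space are those transported by
  the trivialisations.\<close>

type_synonym ('a, 'e, 'n) triv = "'a set \<times> ('e \<Rightarrow> complex ^ 'n)"

record ('a, 'e, 'n::finite) vbundle =
  proj :: "'e \<Rightarrow> 'a"
  trivs :: "('a, 'e, 'n) triv set"

definition bundle_rank :: "('a, 'e, 'n::finite) vbundle \<Rightarrow> nat" where
  "bundle_rank E = CARD('n)"

definition hol_vector_bundle ::
    "('a::t2_space) chart set \<Rightarrow> ('a, 'e, 'n::finite) vbundle \<Rightarrow> bool" where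
  "hol_vector_bundle \<A> E \<longleftrightarrow>
     (\<Union>t\<in>trivs E. fst t) = UNIV \<and>
     (\<forall>t\<in>trivs E. open (fst t) \<and> (\<forall>x\<in>fst t. bij_betw (snd t) (proj E -` {x}) UNIV)) \<and>
     (\<forall>t\<in>trivs E. \<forall>t'\<in>trivs E. \<exists>G. hol_matrix_on_surface \<A> G (fst t \<inter> fst t') \<and>
        (\<forall>e. proj E e \<in> fst t \<inter> fst t' \<longrightarrow> snd t' e = G (proj E e) *v snd t e))"

definition lift :: "('a, 'e, 'n::finite) vbundle \<Rightarrow> ('a, 'e, 'n) triv \<Rightarrow> 'a \<Rightarrow> complex ^ 'n \<Rightarrow> 'e" where
  "lift E t x = inv_into (proj E -` {x}) (snd t)"

definition is_zero :: "('a, 'e, 'n::finite) vbundle \<Rightarrow> 'e \<Rightarrow> bool" where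
  "is_zero E e \<longleftrightarrow> (\<exists>t\<in>trivs E. proj E e \<in> fst t \<and> snd t e = 0)"

text \<open>Holomorphic sections of \<open>Hom(E, E')\<close>, viewed as fibrewise linear maps of total spaces.\<close>

definition hol_hom_section :: "('a::t2_space) chart set \<Rightarrow> ('a, 'e, 'm::finite) vbundle \<Rightarrow>
    ('a, 'f, 'n::finite) vbundle \<Rightarrow> ('e \<Rightarrow> 'f) \<Rightarrow> bool" where
  "hol_hom_section \<A> E E' \<Phi> \<longleftrightarrow>
     (\<forall>e. proj E' (\<Phi> e) = proj E e) \<and>
     (\<forall>t\<in>trivs E. \<forall>t'\<in>trivs E'. \<exists>M. hol_matrix_on_surface \<A> M (fst t \<inter> fst t') \<and>
        (\<forall>e. proj E e \<in> fst t \<inter> fst t' \<longrightarrow> snd t' (\<Phi> e) = M (proj E e) *v snd t e))"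

definition nowhere_vanishing ::
    "('a, 'e, 'm::finite) vbundle \<Rightarrow> ('a, 'f, 'n::finite) vbundle \<Rightarrow> ('e \<Rightarrow> 'f) \<Rightarrow> bool" where
  "nowhere_vanishing E E' \<Phi> \<longleftrightarrow> (\<forall>x. \<exists>e. proj E e = x \<and> \<not> is_zero E' (\<Phi> e))"

definition hol_isomorphic :: "('a::t2_space) chart set \<Rightarrow> ('a, 'e, 'm::finite) vbundle \<Rightarrow>
    ('a, 'f, 'n::finite) vbundle \<Rightarrow> bool" where
  "hol_isomorphic \<A> E E' \<longleftrightarrow>
     (\<exists>\<Psi> \<Psi>'. hol_hom_section \<A> E E' \<Psi> \<and> hol_hom_section \<A> E' E \<Psi>' \<and>
        \<Psi>' \<circ> \<Psi> = id \<and> \<Psi> \<circ> \<Psi>' = id)"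

definition hom_matrix :: "('a, 'e, 'm::finite) vbundle \<Rightarrow> ('a, 'e, 'm) triv \<Rightarrow>
    ('a, 'f, 'n::finite) triv \<Rightarrow> ('e \<Rightarrow> 'f) \<Rightarrow> 'a \<Rightarrow> complex ^ 'm ^ 'n" where
  "hom_matrix E t t' \<Phi> x = matrix (\<lambda>v. snd t' (\<Phi> (lift E t x v)))"

text \<open>A metric \<open>h\<close> is linear in the first and antilinear in the second argument; its values on pairs
  from different fibres are irrelevant.\<close>

definition hermitian_metric :: "('a::t2_space) chart set \<Rightarrow> ('a, 'e, 'n::finite) vbundle \<Rightarrow>
    ('e \<Rightarrow> 'e \<Rightarrow> complex) \<Rightarrow> bool" where
  "hermitian_metric \<A> E h \<longleftrightarrow>
     (\<forall>t\<in>trivs E. \<exists>H. smooth_on_surface \<A> H (fst t) \<and>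
        (\<forall>x\<in>fst t. positive_definite (H x)) \<and>
        (\<forall>e e'. proj E e \<in> fst t \<and> proj E e' = proj E e \<longrightarrow>
           h e e' = hdot (H (proj E e) *v snd t e) (snd t e')))"

text \<open>The matrix \<open>H\<close> of \<open>h\<close> in the frame \<open>(e\<^sub>i)\<close> of \<open>t\<close> is \<open>H\<^sub>i\<^sub>j = h(e\<^sub>j, e\<^sub>i)\<close>, so that \<open>h(v, w) = w\<^sup>* H v\<close>
  and the Chern connection has \<open>\<nabla>\<^sub>z = \<partial>\<^sub>z + H\<^sup>-\<^sup>1 \<partial>\<^sub>z H\<close> on column vectors.\<close>

definition metric_matrix :: "('a, 'e, 'n::finite) vbundle \<Rightarrow> ('e \<Rightarrow> 'e \<Rightarrow> complex) \<Rightarrow>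
    ('a, 'e, 'n) triv \<Rightarrow> 'a \<Rightarrow> complex ^ 'n ^ 'n" where
  "metric_matrix E h t x = (\<chi> i j. h (lift E t x (axis j 1)) (lift E t x (axis i 1)))"

definition chern_connection :: "('a, 'e, 'n::finite) vbundle \<Rightarrow> ('e \<Rightarrow> 'e \<Rightarrow> complex) \<Rightarrow>
    'a chart \<Rightarrow> ('a, 'e, 'n) triv \<Rightarrow> 'a \<Rightarrow> complex ^ 'n ^ 'n" where
  "chern_connection E h c t x =
     matrix_inv (metric_matrix E h t x) ** mat_d_z c (metric_matrix E h t) x"

text \<open>The component \<open>F\<close> of the curvature \<open>F dz \<and> dz-bar\<close>, the exterior \<open>dbar\<close> of the connection form.\<close>

definition chern_curvature :: "('a, 'e, 'n::finite) vbundle \<Rightarrow> ('e \<Rightarrow> 'e \<Rightarrow> complex) \<Rightarrow>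
    'a chart \<Rightarrow> ('a, 'e, 'n) triv \<Rightarrow> 'a \<Rightarrow> complex ^ 'n ^ 'n" where
  "chern_curvature E h c t x = - mat_d_zbar c (chern_connection E h c t) x"

text \<open>\<open>i \<Lambda> F\<close>, characterised by \<open>i F = (i \<Lambda> F) \<omega>\<close>: with \<open>\<omega> = i g dz \<and> dz-bar\<close> the factor is \<open>1/g\<close>.\<close>

definition i_Lambda_F :: "('a chart \<Rightarrow> 'a \<Rightarrow> real) \<Rightarrow> ('a, 'e, 'n::finite) vbundle \<Rightarrow>
    ('e \<Rightarrow> 'e \<Rightarrow> complex) \<Rightarrow> 'a chart \<Rightarrow> ('a, 'e, 'n) triv \<Rightarrow> 'a \<Rightarrow> complex ^ 'n ^ 'n" where
  "i_Lambda_F g E h c t x = (1 / g c x) *\<^sub>R chern_curvature E h c t x"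

text \<open>The trace does not depend on the chart and the trivialisation, and the degree does not depend
  on the metric \<open>h\<close> (Chern--Weil); both are therefore given by definite descriptions.\<close>

definition tr_i_Lambda_F :: "('a::t2_space) chart set \<Rightarrow> ('a chart \<Rightarrow> 'a \<Rightarrow> real) \<Rightarrow>
    ('a, 'e, 'n::finite) vbundle \<Rightarrow> ('e \<Rightarrow> 'e \<Rightarrow> complex) \<Rightarrow> 'a \<Rightarrow> real" where
  "tr_i_Lambda_F \<A> g E h x = Re (THE a. \<forall>c\<in>\<A>. \<forall>t\<in>trivs E. x \<in> fst c \<inter> fst t \<longrightarrow>
     a = trace (i_Lambda_F g E h c t x))"

definition degree :: "('a::t2_space) chart set \<Rightarrow> ('a chart \<Rightarrow> 'a \<Rightarrow> real) \<Rightarrow>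
    ('a, 'e, 'n::finite) vbundle \<Rightarrow> real" where
  "degree \<A> g E = (THE d. \<forall>h. hermitian_metric \<A> E h \<longrightarrow>
     d = (LINT x|area_measure \<A> g. tr_i_Lambda_F \<A> g E h x) / (2 * pi))"

definition vortex_triple :: "('a::t2_space) chart set \<Rightarrow> ('a, 'e1, 'n::finite) vbundle \<Rightarrow>
    ('a, 'e2, 'm::finite) vbundle \<Rightarrow> ('e2 \<Rightarrow> 'e1) \<Rightarrow> bool" where
  "vortex_triple \<A> E1 E2 \<Phi> \<longleftrightarrow> hol_vector_bundle \<A> E1 \<and> hol_vector_bundle \<A> E2 \<and>
     bundle_rank E2 = 1 \<and> hol_hom_section \<A> E2 E1 \<Phi>"

definition central_charge :: "('a::t2_space) chart set \<Rightarrow> ('a chart \<Rightarrow> 'a \<Rightarrow> real) \<Rightarrow>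
    ('a, 'e1, 'n::finite) vbundle \<Rightarrow> ('a, 'e2, 'm::finite) vbundle \<Rightarrow> real \<Rightarrow> complex" where
  "central_charge \<A> g E1 E2 \<sigma> = complex_of_real (\<sigma> / (2 * pi)) *
     Complex (volume \<A> g / (2 * pi) * (real (bundle_rank E1) + 1) - 4 * pi / \<sigma> * degree \<A> g E2)
             (degree \<A> g E1 + degree \<A> g E2 + 2 * volume \<A> g / \<sigma>)"

text \<open>The adjoint \<open>M\<^sup>\<dagger>\<close>, for \<open>M\<close> from the fibre with metric matrix \<open>H2\<close> to the one with \<open>H1\<close>.\<close>

definition hom_adjoint :: "complex ^ 'n ^ 'n \<Rightarrow> complex ^ 'm ^ 'm \<Rightarrow> complex ^ 'm ^ 'n \<Rightarrow>
    complex ^ 'n ^ 'm" where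
  "hom_adjoint H1 H2 M = matrix_inv H2 ** ctranspose M ** H1"

text \<open>Strict positivity of an endomorphism \<open>B\<close> with respect to the metric matrix \<open>H\<close>: self-adjointness
  of \<open>B\<close> amounts to \<open>H B\<close> being Hermitian.\<close>

definition positive_endo :: "complex ^ 'n ^ 'n \<Rightarrow> complex ^ 'n ^ 'n \<Rightarrow> bool" where
  "positive_endo H B \<longleftrightarrow> positive_definite (H ** B)"

text \<open>The remaining quantities are matrices and scalars at a point \<open>x\<close> in a chart \<open>c\<close> and
  trivialisations \<open>t1\<close>, \<open>t2\<close> of \<open>E1\<close>, \<open>E2\<close> around \<open>x\<close>.\<close>

definition Phi_Phi_adj :: "('a, 'e1, 'n::finite) vbundle \<Rightarrow> ('a, 'e2, 'm::finite) vbundle \<Rightarrow>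
    ('e2 \<Rightarrow> 'e1) \<Rightarrow> ('e1 \<Rightarrow> 'e1 \<Rightarrow> complex) \<Rightarrow> ('e2 \<Rightarrow> 'e2 \<Rightarrow> complex) \<Rightarrow>
    ('a, 'e1, 'n) triv \<Rightarrow> ('a, 'e2, 'm) triv \<Rightarrow> 'a \<Rightarrow> complex ^ 'n ^ 'n" where
  "Phi_Phi_adj E1 E2 \<Phi> h1 h2 t1 t2 x =
     (let M = hom_matrix E2 t2 t1 \<Phi> x in
      M ** hom_adjoint (metric_matrix E1 h1 t1 x) (metric_matrix E2 h2 t2 x) M)"

definition norm2_Phi :: "('a, 'e1, 'n::finite) vbundle \<Rightarrow> ('a, 'e2, 'm::finite) vbundle \<Rightarrow>
    ('e2 \<Rightarrow> 'e1) \<Rightarrow> ('e1 \<Rightarrow> 'e1 \<Rightarrow> complex) \<Rightarrow> ('e2 \<Rightarrow> 'e2 \<Rightarrow> complex) \<Rightarrow>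
    ('a, 'e1, 'n) triv \<Rightarrow> ('a, 'e2, 'm) triv \<Rightarrow> 'a \<Rightarrow> real" where
  "norm2_Phi E1 E2 \<Phi> h1 h2 t1 t2 x = Re (trace (Phi_Phi_adj E1 E2 \<Phi> h1 h2 t1 t2 x))"

definition nabla_Phi :: "('a, 'e1, 'n::finite) vbundle \<Rightarrow> ('a, 'e2, 'm::finite) vbundle \<Rightarrow>
    ('e2 \<Rightarrow> 'e1) \<Rightarrow> ('e1 \<Rightarrow> 'e1 \<Rightarrow> complex) \<Rightarrow> ('e2 \<Rightarrow> 'e2 \<Rightarrow> complex) \<Rightarrow>
    'a chart \<Rightarrow> ('a, 'e1, 'n) triv \<Rightarrow> ('a, 'e2, 'm) triv \<Rightarrow> 'a \<Rightarrow> complex ^ 'm ^ 'n" where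
  "nabla_Phi E1 E2 \<Phi> h1 h2 c t1 t2 x =
     mat_d_z c (hom_matrix E2 t2 t1 \<Phi>) x
     + chern_connection E1 h1 c t1 x ** hom_matrix E2 t2 t1 \<Phi> x
     - hom_matrix E2 t2 t1 \<Phi> x ** chern_connection E2 h2 c t2 x"

definition nabla_Phi_nabla_Phi_adj :: "('a chart \<Rightarrow> 'a \<Rightarrow> real) \<Rightarrow>
    ('a, 'e1, 'n::finite) vbundle \<Rightarrow> ('a, 'e2, 'm::finite) vbundle \<Rightarrow>
    ('e2 \<Rightarrow> 'e1) \<Rightarrow> ('e1 \<Rightarrow> 'e1 \<Rightarrow> complex) \<Rightarrow> ('e2 \<Rightarrow> 'e2 \<Rightarrow> complex) \<Rightarrow>
    'a chart \<Rightarrow> ('a, 'e1, 'n) triv \<Rightarrow> ('a, 'e2, 'm) triv \<Rightarrow> 'a \<Rightarrow> complex ^ 'n ^ 'n" where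
  "nabla_Phi_nabla_Phi_adj g E1 E2 \<Phi> h1 h2 c t1 t2 x =
     (let N = nabla_Phi E1 E2 \<Phi> h1 h2 c t1 t2 x in
      (1 / g c x) *\<^sub>R
        (N ** hom_adjoint (metric_matrix E1 h1 t1 x) (metric_matrix E2 h2 t2 x) N))"

definition norm2_nabla_Phi :: "('a chart \<Rightarrow> 'a \<Rightarrow> real) \<Rightarrow>
    ('a, 'e1, 'n::finite) vbundle \<Rightarrow> ('a, 'e2, 'm::finite) vbundle \<Rightarrow>
    ('e2 \<Rightarrow> 'e1) \<Rightarrow> ('e1 \<Rightarrow> 'e1 \<Rightarrow> complex) \<Rightarrow> ('e2 \<Rightarrow> 'e2 \<Rightarrow> complex) \<Rightarrow>
    'a chart \<Rightarrow> ('a, 'e1, 'n) triv \<Rightarrow> ('a, 'e2, 'm) triv \<Rightarrow> 'a \<Rightarrow> real" where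
  "norm2_nabla_Phi g E1 E2 \<Phi> h1 h2 c t1 t2 x =
     Re (trace (nabla_Phi_nabla_Phi_adj g E1 E2 \<Phi> h1 h2 c t1 t2 x))"

text \<open>Both equations and both constraints are built from the expressions below, one pair in
  \<open>End(E1)\<close> and one in \<open>End(E2)\<close>. The scalars of the equation on the line bundle \<open>E2\<close> are written as
  multiples of the identity \<open>mat 1\<close>.\<close>

definition im_part1 :: "('a chart \<Rightarrow> 'a \<Rightarrow> real) \<Rightarrow>
    ('a, 'e1, 'n::finite) vbundle \<Rightarrow> ('a, 'e2, 'm::finite) vbundle \<Rightarrow>
    ('e2 \<Rightarrow> 'e1) \<Rightarrow> ('e1 \<Rightarrow> 'e1 \<Rightarrow> complex) \<Rightarrow> ('e2 \<Rightarrow> 'e2 \<Rightarrow> complex) \<Rightarrow>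
    'a chart \<Rightarrow> ('a, 'e1, 'n) triv \<Rightarrow> ('a, 'e2, 'm) triv \<Rightarrow> 'a \<Rightarrow> complex ^ 'n ^ 'n" where
  "im_part1 g E1 E2 \<Phi> h1 h2 c t1 t2 x =
     i_Lambda_F g E1 h1 c t1 x + Phi_Phi_adj E1 E2 \<Phi> h1 h2 t1 t2 x"

definition re_part1 :: "('a chart \<Rightarrow> 'a \<Rightarrow> real) \<Rightarrow>
    ('a, 'e1, 'n::finite) vbundle \<Rightarrow> ('a, 'e2, 'm::finite) vbundle \<Rightarrow>
    ('e2 \<Rightarrow> 'e1) \<Rightarrow> ('e1 \<Rightarrow> 'e1 \<Rightarrow> complex) \<Rightarrow> ('e2 \<Rightarrow> 'e2 \<Rightarrow> complex) \<Rightarrow>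
    'a chart \<Rightarrow> ('a, 'e1, 'n) triv \<Rightarrow> ('a, 'e2, 'm) triv \<Rightarrow> 'a \<Rightarrow> complex ^ 'n ^ 'n" where
  "re_part1 g E1 E2 \<Phi> h1 h2 c t1 t2 x =
     mat 1
     - (1/2) *\<^sub>R anticomm (i_Lambda_F g E1 h1 c t1 x) (Phi_Phi_adj E1 E2 \<Phi> h1 h2 t1 t2 x)
     + (1/2) *\<^sub>R nabla_Phi_nabla_Phi_adj g E1 E2 \<Phi> h1 h2 c t1 t2 x"

definition im_part2 :: "('a chart \<Rightarrow> 'a \<Rightarrow> real) \<Rightarrow>
    ('a, 'e1, 'n::finite) vbundle \<Rightarrow> ('a, 'e2, 'm::finite) vbundle \<Rightarrow>
    ('e2 \<Rightarrow> 'e1) \<Rightarrow> ('e1 \<Rightarrow> 'e1 \<Rightarrow> complex) \<Rightarrow> ('e2 \<Rightarrow> 'e2 \<Rightarrow> complex) \<Rightarrow> real \<Rightarrow>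
    'a chart \<Rightarrow> ('a, 'e1, 'n) triv \<Rightarrow> ('a, 'e2, 'm) triv \<Rightarrow> 'a \<Rightarrow> complex ^ 'm ^ 'm" where
  "im_part2 g E1 E2 \<Phi> h1 h2 \<sigma> c t1 t2 x =
     i_Lambda_F g E2 h2 c t2 x + (4 * pi / \<sigma> - norm2_Phi E1 E2 \<Phi> h1 h2 t1 t2 x) *\<^sub>R mat 1"

definition re_part2 :: "('a chart \<Rightarrow> 'a \<Rightarrow> real) \<Rightarrow>
    ('a, 'e1, 'n::finite) vbundle \<Rightarrow> ('a, 'e2, 'm::finite) vbundle \<Rightarrow>
    ('e2 \<Rightarrow> 'e1) \<Rightarrow> ('e1 \<Rightarrow> 'e1 \<Rightarrow> complex) \<Rightarrow> ('e2 \<Rightarrow> 'e2 \<Rightarrow> complex) \<Rightarrow> real \<Rightarrow>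
    'a chart \<Rightarrow> ('a, 'e1, 'n) triv \<Rightarrow> ('a, 'e2, 'm) triv \<Rightarrow> 'a \<Rightarrow> complex ^ 'm ^ 'm" where
  "re_part2 g E1 E2 \<Phi> h1 h2 \<sigma> c t1 t2 x =
     mat 1
     + (norm2_Phi E1 E2 \<Phi> h1 h2 t1 t2 x - 4 * pi / \<sigma>) *\<^sub>R i_Lambda_F g E2 h2 c t2 x
     + (1/2 * norm2_nabla_Phi g E1 E2 \<Phi> h1 h2 c t1 t2 x) *\<^sub>R mat 1"

definition deformed_vortex_equations :: "('a::t2_space) chart set \<Rightarrow> ('a chart \<Rightarrow> 'a \<Rightarrow> real) \<Rightarrow>
    ('a, 'e1, 'n::finite) vbundle \<Rightarrow> ('a, 'e2, 'm::finite) vbundle \<Rightarrow> ('e2 \<Rightarrow> 'e1) \<Rightarrow>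
    ('e1 \<Rightarrow> 'e1 \<Rightarrow> complex) \<Rightarrow> ('e2 \<Rightarrow> 'e2 \<Rightarrow> complex) \<Rightarrow> real \<Rightarrow> real \<Rightarrow> bool" where
  "deformed_vortex_equations \<A> g E1 E2 \<Phi> h1 h2 \<sigma> \<theta> \<longleftrightarrow>
     (\<forall>c\<in>\<A>. \<forall>t1\<in>trivs E1. \<forall>t2\<in>trivs E2. \<forall>x\<in>fst c \<inter> fst t1 \<inter> fst t2.
        cos \<theta> *\<^sub>R im_part1 g E1 E2 \<Phi> h1 h2 c t1 t2 x
          = sin \<theta> *\<^sub>R re_part1 g E1 E2 \<Phi> h1 h2 c t1 t2 x \<and>
        cos \<theta> *\<^sub>R im_part2 g E1 E2 \<Phi> h1 h2 \<sigma> c t1 t2 x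
          = sin \<theta> *\<^sub>R re_part2 g E1 E2 \<Phi> h1 h2 \<sigma> c t1 t2 x)"

definition calibration_constraint :: "('a::t2_space) chart set \<Rightarrow> ('a chart \<Rightarrow> 'a \<Rightarrow> real) \<Rightarrow>
    ('a, 'e1, 'n::finite) vbundle \<Rightarrow> ('a, 'e2, 'm::finite) vbundle \<Rightarrow> ('e2 \<Rightarrow> 'e1) \<Rightarrow>
    ('e1 \<Rightarrow> 'e1 \<Rightarrow> complex) \<Rightarrow> ('e2 \<Rightarrow> 'e2 \<Rightarrow> complex) \<Rightarrow> real \<Rightarrow> real \<Rightarrow> bool" where
  "calibration_constraint \<A> g E1 E2 \<Phi> h1 h2 \<sigma> \<theta> \<longleftrightarrow>
     (\<forall>c\<in>\<A>. \<forall>t1\<in>trivs E1. \<forall>t2\<in>trivs E2. \<forall>x\<in>fst c \<inter> fst t1 \<inter> fst t2.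
        positive_endo (metric_matrix E1 h1 t1 x)
          (cos \<theta> *\<^sub>R re_part1 g E1 E2 \<Phi> h1 h2 c t1 t2 x
           + sin \<theta> *\<^sub>R im_part1 g E1 E2 \<Phi> h1 h2 c t1 t2 x) \<and>
        positive_endo (metric_matrix E2 h2 t2 x)
          (cos \<theta> *\<^sub>R re_part2 g E1 E2 \<Phi> h1 h2 \<sigma> c t1 t2 x
           + sin \<theta> *\<^sub>R im_part2 g E1 E2 \<Phi> h1 h2 \<sigma> c t1 t2 x))"

definition constant_i_Lambda_F :: "('a::t2_space) chart set \<Rightarrow> ('a chart \<Rightarrow> 'a \<Rightarrow> real) \<Rightarrow>
    ('a, 'e, 'n::finite) vbundle \<Rightarrow> ('e \<Rightarrow> 'e \<Rightarrow> complex) \<Rightarrow> real \<Rightarrow> bool" where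
  "constant_i_Lambda_F \<A> g E h a \<longleftrightarrow>
     (\<forall>c\<in>\<A>. \<forall>t\<in>trivs E. \<forall>x\<in>fst c \<inter> fst t. i_Lambda_F g E h c t x = a *\<^sub>R mat 1)"

definition constant_norm2_Phi :: "('a, 'e1, 'n::finite) vbundle \<Rightarrow>
    ('a, 'e2, 'm::finite) vbundle \<Rightarrow> ('e2 \<Rightarrow> 'e1) \<Rightarrow> ('e1 \<Rightarrow> 'e1 \<Rightarrow> complex) \<Rightarrow>
    ('e2 \<Rightarrow> 'e2 \<Rightarrow> complex) \<Rightarrow> real \<Rightarrow> bool" where
  "constant_norm2_Phi E1 E2 \<Phi> h1 h2 a \<longleftrightarrow>
     (\<forall>t1\<in>trivs E1. \<forall>t2\<in>trivs E2. \<forall>x\<in>fst t1 \<inter> fst t2.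
        norm2_Phi E1 E2 \<Phi> h1 h2 t1 t2 x = a)"

end

theory Submission
  imports Defs
begin

text \<open>
Only the maximum principle is needed; no integration enters. On the kernel of \<open>\<Phi>\<^sup>\<dagger>\<close> the first
equation contradicts the calibration constraint when \<open>cos \<theta> \<le> 0 < sin \<theta>\<close>, so \<open>E1\<close> is a line bundle and
\<open>\<Phi>\<close> has no zeros. For line bundles, put \<open>c = cos \<theta>\<close>, \<open>s = sin \<theta>\<close>, \<open>F = |\<Phi>|\<^sup>2\<close> and
\<open>k(y) = (s - c y) / (c + s y)\<close>, which is strictly decreasing. Then
\<open>|\<nabla>\<Phi>|\<^sup>2 = F |\<partial> log F|\<^sup>2\<close> vanishes where \<open>F\<close> is extremal, and there the two equations read
\<open>i\<Lambda>F\<^sub>1 = k(F)\<close> and \<open>i\<Lambda>F\<^sub>2 = k(4\<pi>/\<sigma> - F)\<close>, the calibration constraint making both denominators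
positive. Since \<open>i\<Lambda>F\<^sub>2 - i\<Lambda>F\<^sub>1\<close> is a positive multiple of the Laplacian of \<open>log F\<close>, a maximum has
\<open>F \<le> 4\<pi>/\<sigma> - F\<close> and a minimum the reverse inequality, so \<open>F\<close> is constantly \<open>2\<pi>/\<sigma>\<close>.
\<close>

unbundle no fps_syntax

section \<open>Calibrated endomorphisms at a point\<close>

text \<open>For line bundles both equations are one scalar problem. Let A be the curvature, n =
  |nabla \<Phi>|^2, and y = |\<Phi>|^2 for E1 but y = 4 pi/\<sigma> - |\<Phi>|^2 for E2. Equation
  and constraint together say that (1 + iA)(1 + iy) + n/2 is a positive multiple of e^(i \<theta>).
  For n = 0 this means arctan A + arctan y = \<theta>, so A = tan(\<theta> - arctan y), which is the
  function k. The value 2 pi/\<sigma> is the fixed point of y -> 4 pi/\<sigma> - y, the exchange of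
  the two problems. The adjoint of \<Phi> maps into a line, so its kernel is nonzero if E1 has rank
  above 1 and at every zero of \<Phi>. This has to be settled before log |\<Phi>|^2 is available
  everywhere. A second obstacle is that |\<Phi>|^2 is given in frames: compactness yields extrema
  only after it is known to be one continuous function on the surface.\<close>

lemma hdot_adjoint: "hdot (M *v v) w = hdot v (ctranspose M *v w)"
proof -
  have "hdot (M *v v) w = (\<Sum>i\<in>UNIV. \<Sum>j\<in>UNIV. M $ i $ j * v $ j * cnj (w $ i))"
    by (simp add: hdot_def matrix_vector_mult_def sum_distrib_right)
  also have "\<dots> = (\<Sum>j\<in>UNIV. \<Sum>i\<in>UNIV. M $ i $ j * v $ j * cnj (w $ i))"
    by (rule sum.swap)
  also have "\<dots> = hdot v (ctranspose M *v w)"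
    by (simp add: hdot_def matrix_vector_mult_def ctranspose_def sum_distrib_left algebra_simps)
  finally show ?thesis .
qed

lemma hdot_cnj: "cnj (hdot v w) = hdot w v"
  by (simp add: hdot_def mult.commute)

lemma hdot_zero_right [simp]: "hdot v 0 = 0"
  by (simp add: hdot_def)

lemma hdot_zero_left [simp]: "hdot 0 v = 0"
  by (simp add: hdot_def)

lemma hdot_add_left: "hdot (u + v) w = hdot u w + hdot v w"
  by (simp add: hdot_def sum.distrib algebra_simps)

lemma hdot_scaleR_left: "hdot (r *\<^sub>R v) w = r *\<^sub>R hdot v w"
  by (simp add: hdot_def scaleR_right.sum)

lemma scaleR_matrix_vector: "(r *\<^sub>R M) *v v = r *\<^sub>R (M *v v)" for M :: "complex ^ 'n ^ 'm"
  by (simp add: matrix_vector_mult_def vec_eq_iff scaleR_right.sum)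

lemma matrix_vector_scaleR: "M *v (r *\<^sub>R v) = r *\<^sub>R (M *v v)" for M :: "complex ^ 'n ^ 'm"
  by (simp add: matrix_vector_mult_def vec_eq_iff scaleR_right.sum)

lemma matrix_mult_inv_right:
  fixes A :: "'f::semiring_1 ^ 'n ^ 'n"
  assumes "invertible A" shows "A ** matrix_inv A = mat 1"
  using someI_ex[OF assms[unfolded invertible_def]] by (simp add: matrix_inv_def)

lemma positive_definite_invertible:
  assumes "positive_definite H" shows "invertible H"
proof -
  have "\<forall>v. H *v v = 0 \<longrightarrow> v = 0"
    using assms unfolding positive_definite_def by force
  then show ?thesis
    by (simp add: invertible_left_inverse matrix_left_invertible_ker)
qed

text \<open>With \<open>?w\<close> the preimage of \<open>u\<close> under \<open>H\<close>, the form
  of the inverse at \<open>u\<close> is the conjugate of the form of \<open>H\<close> at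
  \<open>?w\<close>, and only real parts are compared.\<close>

lemma positive_definite_inverse_nonneg:
  assumes "positive_definite H" shows "0 \<le> Re (hdot (matrix_inv H *v u) u)"
proof -
  let ?w = "matrix_inv H *v u"
  have u: "H *v ?w = u"
    using matrix_mult_inv_right[OF positive_definite_invertible[OF assms]]
    by (simp add: matrix_vector_mul_assoc)
  have "Re (hdot ?w u) = Re (hdot (H *v ?w) ?w)"
    using hdot_cnj[of ?w u] by (metis complex_cnj cnj.simps(1) u)
  also have "\<dots> \<ge> 0"
    using assms unfolding positive_definite_def by (cases "?w = 0") (auto intro: less_imp_le)
  finally show ?thesis .
qed

text \<open>For Hermitian \<open>H2\<close> the right-hand side is the inner product in the source
  of \<open>M\<close> of the adjoints applied to \<open>w\<close> and \<open>v\<close>. It vanishes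
  if the adjoint kills \<open>v\<close>, and for \<open>w = v\<close> it is a value of the form of
  the inverse of \<open>H2\<close>, hence nonnegative in the positive definite case.\<close>

lemma hdot_mult_hom_adjoint:
  assumes "ctranspose H1 = H1"
  shows "hdot (H1 *v ((M ** hom_adjoint H1 H2 M) *v w)) v
    = hdot (matrix_inv H2 *v (ctranspose M *v (H1 *v w))) (ctranspose M *v (H1 *v v))"
proof -
  have "hdot (H1 *v ((M ** hom_adjoint H1 H2 M) *v w)) v
      = hdot (M *v (matrix_inv H2 *v (ctranspose M *v (H1 *v w)))) (H1 *v v)"
    unfolding hdot_adjoint[of H1] assms by (simp add: hom_adjoint_def matrix_vector_mul_assoc matrix_mul_assoc)
  then show ?thesis by (simp add: hdot_adjoint[of M])
qed

text \<open>On the kernel of \<open>M\<^sup>\<dagger>\<close> the first vortex equation reads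
  \<open>cos \<theta> \<langle>A v, v\<rangle> = sin \<theta> (|v|\<^sup>2 + nonnegative)\<close>, while the calibration constraint says
  \<open>\<langle>A v, v\<rangle> > 0\<close>.\<close>

lemma calibrated_kernel_trivial:
  fixes M N :: "complex ^ 'm ^ 'n" and H1 A :: "complex ^ 'n ^ 'n" and H2 :: "complex ^ 'm ^ 'm" and c s k :: real
  defines "P \<equiv> M ** hom_adjoint H1 H2 M"
  defines "R \<equiv> mat 1 - (1/2) *\<^sub>R anticomm A P + (1/2) *\<^sub>R k *\<^sub>R (N ** hom_adjoint H1 H2 N)"
  assumes H: "positive_definite H1" "positive_definite H2"
    and c: "c \<le> 0" and s: "s > 0" and k: "k \<ge> 0"
    and eq: "c *\<^sub>R (A + P) = s *\<^sub>R R"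
    and pos: "positive_endo H1 (c *\<^sub>R R + s *\<^sub>R (A + P))"
    and ker: "ctranspose M *v (H1 *v v) = 0"
  shows "v = 0"
proof (rule ccontr)
  assume v: "v \<noteq> 0"
  \<comment> \<open>Pairing with the fixed \<open>v\<close> turns the equation between endomorphisms
    into one between real numbers.\<close>
  define q where "q B = Re (hdot (H1 *v (B *v v)) v)" for B
  have q_add: "q (B + C) = q B + q C" for B C
    by (simp add: q_def hdot_add_left matrix_vector_mult_add_rdistrib matrix_vector_right_distrib)
  have q_scale: "q (r *\<^sub>R B) = r * q B" for r B
    by (simp add: q_def hdot_scaleR_left scaleR_matrix_vector matrix_vector_scaleR)
  have q_diff: "q (B - C) = q B - q C" for B C
    using q_add[of B "-1 *\<^sub>R C"] q_scale[of "-1" C] by simp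
  have H1: "ctranspose H1 = H1" using H(1) by (simp add: positive_definite_def)
  \<comment> \<open>Arbitrary \<open>w\<close> is needed for the summand \<open>P ** A\<close> of
    the anticommutator: there \<open>P\<close> acts on \<open>A *v v\<close>, and only the pairing
    with \<open>v\<close> makes the term vanish.\<close>
  have hP: "hdot (H1 *v (P *v w)) v = 0" for w
    unfolding P_def by (simp add: hdot_mult_hom_adjoint[OF H1] ker)
  have Pv: "P *v v = 0"
    using ker by (simp add: P_def hom_adjoint_def flip: matrix_vector_mul_assoc)
  have qP: "q P = 0" using Pv by (simp add: q_def)
  have "q (A ** P) = 0" "q (P ** A) = 0"
    using Pv hP by (simp_all add: q_def flip: matrix_vector_mul_assoc)
  then have q_anti: "q (anticomm A P) = 0" by (simp add: anticomm_def q_add)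
  have q1: "q (mat 1) > 0" using H(1) v by (simp add: q_def positive_definite_def)
  have qN: "q (N ** hom_adjoint H1 H2 N) \<ge> 0"
    unfolding q_def hdot_mult_hom_adjoint[OF H1] by (rule positive_definite_inverse_nonneg[OF H(2)])
  have qR: "q R > 0"
    using q1 qN k by (simp add: R_def q_add q_diff q_scale q_anti add_pos_nonneg)
  have qeq: "c * q A = s * q R"
    using arg_cong[OF eq, of q] by (simp add: q_scale q_add qP)
  have "q (c *\<^sub>R R + s *\<^sub>R (A + P)) > 0"
    using pos v by (simp add: positive_endo_def positive_definite_def q_def matrix_vector_mul_assoc)
  then have "c * q R + s * q A > 0" by (simp add: q_add q_scale qP)
  \<comment> \<open>The signs now collide: the constraint forces \<open>q A > 0\<close>, so the left
    side of \<open>qeq\<close> is at most 0 while its right side is positive.\<close>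
  moreover have "c * q R \<le> 0" using c qR by (simp add: mult_nonpos_nonneg)
  ultimately have "s * q A > 0" by linarith
  then have "q A > 0" using s by (simp add: zero_less_mult_iff)
  then have "c * q A \<le> 0" using c by (simp add: mult_nonpos_nonneg)
  moreover have "s * q R > 0" using s qR by simp
  ultimately show False using qeq by linarith
qed

text \<open>A matrix with a single row and at least two columns: the row entries p, q at two columns
  annihilate the vector with entries -q, p there, and if p = 0 the first of the two basis vectors
  already works.\<close>

lemma exists_kernel_vector:
  fixes L :: "complex ^ 'n ^ 'm"
  assumes "CARD('m) = 1" "CARD('n) \<noteq> 1"
  shows "\<exists>v. v \<noteq> 0 \<and> L *v v = 0"
proof -
  obtain b where b: "UNIV = {b :: 'm}" using assms(1) card_1_singletonE by blast
  obtain i j :: 'n where ij: "i \<noteq> j"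
    using assms(2) by (metis (full_types) UNIV_eq_I card_1_singleton_iff insertI1 One_nat_def singletonI)
  have L: "(L *v v) = 0 \<longleftrightarrow> (\<Sum>k\<in>UNIV. L $ b $ k * v $ k) = 0" for v
    using b by (auto simp: matrix_vector_mult_def vec_eq_iff)
  show ?thesis
  proof (cases "L $ b $ i = 0")
    case True
    then have "L *v axis i 1 = 0"
      by (simp add: L axis_def if_distrib cong: if_cong)
    moreover have "axis i 1 \<noteq> (0 :: complex ^ 'n)" by (simp add: axis_eq_0_iff)
    ultimately show ?thesis by blast
  next
    case False
    let ?v = "(\<chi> k. if k = i then - L $ b $ j else if k = j then L $ b $ i else 0) :: complex ^ 'n"
    have "(\<Sum>k\<in>UNIV. L $ b $ k * ?v $ k) = (\<Sum>k\<in>{i, j}. L $ b $ k * ?v $ k)"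
      by (rule sum.mono_neutral_right) auto
    also have "\<dots> = 0" using ij by simp
    finally have "L *v ?v = 0" by (simp add: L)
    moreover have "?v $ j \<noteq> 0" using ij False by simp
    then have "?v \<noteq> 0" by (metis zero_index)
    ultimately show ?thesis by blast
  qed
qed

lemma matrix_inv_1x1:
  fixes A :: "'f::field ^ 'n ^ 'n"
  assumes "UNIV = {a :: 'n}" "A $ a $ a \<noteq> 0"
  shows "matrix_inv A $ a $ a = inverse (A $ a $ a)"
proof -
  have all: "i = a" for i :: 'n using assms(1) by blast
  have "A ** (\<chi> i j. inverse (A $ a $ a)) = mat 1"
    using assms(2) by (simp add: matrix_matrix_mult_def assms(1) mat_def vec_eq_iff all[of "_ :: 'n"])
      (metis all right_inverse)
  then have "invertible A" by (metis invertible_right_inverse)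
  then have "(A ** matrix_inv A) $ a $ a = 1" by (simp add: matrix_mult_inv_right mat_def)
  then show ?thesis using assms(2) by (simp add: matrix_matrix_mult_def assms(1) field_simps)
qed

section \<open>Wirtinger calculus and the maximum principle\<close>

text \<open>Together with \<open>wirt_zbar\<close> this is \<open>d_z\<close> and
  \<open>d_zbar\<close> with the chart stripped off, so that the analysis takes place on open
  subsets of the plane.\<close>

definition wirt_z :: "(complex \<Rightarrow> complex) \<Rightarrow> complex \<Rightarrow> complex" where
  "wirt_z F z = (frechet_derivative F (at z) 1 - \<i> * frechet_derivative F (at z) \<i>) / 2"

definition wirt_zbar :: "(complex \<Rightarrow> complex) \<Rightarrow> complex \<Rightarrow> complex" where
  "wirt_zbar F z = (frechet_derivative F (at z) 1 + \<i> * frechet_derivative F (at z) \<i>) / 2"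

section \<open>Locality of derivatives, and Wirtinger derivatives of holomorphic functions\<close>

lemma has_derivative_cong_open:
  assumes "open S" "z \<in> S" "\<And>w. w \<in> S \<Longrightarrow> F w = G w"
  shows "(F has_derivative D) (at z) \<longleftrightarrow> (G has_derivative D) (at z)"
  using has_derivative_transform_within_open[of F D z UNIV S G]
    has_derivative_transform_within_open[of G D z UNIV S F] assms by auto

lemma frechet_derivative_cong_open:
  assumes "open S" "z \<in> S" "\<And>w. w \<in> S \<Longrightarrow> F w = G w"
  shows "frechet_derivative F (at z) = frechet_derivative G (at z)"
  unfolding frechet_derivative_def using has_derivative_cong_open[OF assms] by simp

lemma wirt_zbar_diff:
  assumes "F differentiable (at z)" "G differentiable (at z)"
  shows "wirt_zbar (\<lambda>w. F w - G w) z = wirt_zbar F z - wirt_zbar G z"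
proof -
  have "frechet_derivative (\<lambda>w. F w - G w) (at z) =
    (\<lambda>v. frechet_derivative F (at z) v - frechet_derivative G (at z) v)"
    by (rule frechet_derivative_at[symmetric]) (intro has_derivative_diff assms[unfolded frechet_derivative_works])
  then show ?thesis by (simp add: wirt_zbar_def algebra_simps diff_divide_distrib add_divide_distrib)
qed

lemma wirt_zbar_holomorphic:
  assumes "F holomorphic_on S" "open S" "z \<in> S"
  shows "wirt_zbar F z = 0"
proof -
  have "(F has_derivative (*) (deriv F z)) (at z)"
    using holomorphic_derivI[OF assms] by (simp add: has_field_derivative_def)
  then have "frechet_derivative F (at z) = (*) (deriv F z)" by (rule frechet_derivative_at[symmetric])
  then show ?thesis by (simp add: wirt_zbar_def algebra_simps)
qed

lemma wirt_z_holomorphic: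
  assumes "F holomorphic_on S" "open S" "z \<in> S"
  shows "wirt_z F z = deriv F z"
proof -
  have "(F has_derivative (*) (deriv F z)) (at z)"
    using holomorphic_derivI[OF assms] by (simp add: has_field_derivative_def)
  then have "frechet_derivative F (at z) = (*) (deriv F z)" by (rule frechet_derivative_at[symmetric])
  then show ?thesis by (simp add: wirt_z_def algebra_simps)
qed

text \<open>If \<open>d\<close> were positive, \<open>f'\<close> would rise from its value 0 at the
  origin and be positive just to the right, so \<open>f\<close> would exceed \<open>f 0\<close>
  there. Differentiability of \<open>f'\<close> at 0 alone suffices for this.\<close>

lemma local_max_second_derivative:
  fixes f f' :: "real \<Rightarrow> real"
  assumes e: "e > 0" and f: "\<And>t. \<bar>t\<bar> < e \<Longrightarrow> (f has_real_derivative f' t) (at t)"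
    and f': "(f' has_real_derivative d) (at 0)"
    and max: "\<And>t. \<bar>t\<bar> < e \<Longrightarrow> f t \<le> f 0"
  shows "f' 0 = 0" "d \<le> 0"
proof -
  show 0: "f' 0 = 0"
    by (rule DERIV_local_max[OF f[of 0] e]) (use e max in auto)
  show "d \<le> 0"
  proof (rule ccontr)
    assume "\<not> d \<le> 0"
    then obtain r where r: "r > 0" "\<And>h. \<lbrakk>h > 0; h < r\<rbrakk> \<Longrightarrow> f' 0 < f' (0 + h)"
      using DERIV_pos_inc_right[OF f'] by auto
    define t where "t = min r e / 2"
    have t: "0 < t" "t < r" "t < e" using r(1) e by (auto simp: t_def min_def)
    have "f 0 < f t"
    proof (rule DERIV_pos_imp_increasing_open[OF t(1)])
      show "\<exists>y. DERIV f x :> y \<and> y > 0" if "0 < x" "x < t" for x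
        using r(2)[of x] f[of x] that t 0 by (intro exI[of _ "f' x"]) auto
      show "continuous_on {0..t} f"
      proof (intro continuous_at_imp_continuous_on ballI)
        show "isCont f x" if "x \<in> {0..t}" for x
          by (rule DERIV_isCont[OF f]) (use that t in auto)
      qed
    qed
    then show False using max[of t] t by auto
  qed
qed

text \<open>The hypothesis on \<open>L\<close> says that \<open>G\<close> is its z-derivative, so
  \<open>wirt_zbar G\<close> is a quarter of the Laplacian of \<open>L\<close>. The one-variable
  test along the real and the imaginary axis gives two inequalities whose sum is the claim.\<close>

lemma wirtinger_local_max:
  fixes L :: "complex \<Rightarrow> real" and G :: "complex \<Rightarrow> complex"
  assumes W: "open W" "z \<in> W"
    and L: "\<And>w. w \<in> W \<Longrightarrow> (L has_derivative (\<lambda>v. 2 * Re (G w * v))) (at w)"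
    and G: "G differentiable (at z)"
    and max: "\<And>w. w \<in> W \<Longrightarrow> L w \<le> L z"
  shows "G z = 0" "Re (wirt_zbar G z) \<le> 0"
proof -
  let ?D = "frechet_derivative G (at z)"
  obtain e where e: "e > 0" "ball z e \<subseteq> W" using W open_contains_ball by blast
  \<comment> \<open>First and second derivative at \<open>z\<close> of the restriction of
    \<open>L\<close> to the line through \<open>z\<close> in direction \<open>v\<close>.\<close>
  have dir: "2 * Re (G z * v) = 0 \<and> 2 * Re (?D v * v) \<le> 0" if v: "cmod v = 1" for v
  proof -
    have W': "z + of_real t * v \<in> W" if "\<bar>t\<bar> < e" for t
      using that v e(2) by (intro subsetD[OF e(2)]) (simp add: dist_norm norm_mult)
    have line: "((\<lambda>t. z + of_real t * v) has_derivative (\<lambda>h. of_real h * v)) (at t)" for t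
      by (auto intro!: derivative_eq_intros)
    have 1: "((\<lambda>t. L (z + of_real t * v)) has_real_derivative 2 * Re (G (z + of_real t * v) * v)) (at t)"
      if "\<bar>t\<bar> < e" for t
    proof -
      have "(\<lambda>h. 2 * Re (G (z + of_real t * v) * (of_real h * v))) = (*) (2 * Re (G (z + of_real t * v) * v))"
        by (auto simp: algebra_simps)
      then show ?thesis
        using has_derivative_compose[OF line L[OF W'[OF that]]] by (simp add: has_field_derivative_def)
    qed
    have "((\<lambda>t. G (z + of_real t * v)) has_derivative (\<lambda>h. ?D (of_real h * v))) (at 0)"
      using has_derivative_compose[OF line[of 0], of G ?D] G
      by (simp add: frechet_derivative_works)
    moreover have "?D (of_real h * v) = h *\<^sub>R ?D v" for h
      using linear_cmul[OF linear_frechet_derivative[OF G]] by (simp add: scaleR_conv_of_real)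
    ultimately have 2: "((\<lambda>t. 2 * Re (G (z + of_real t * v) * v)) has_real_derivative 2 * Re (?D v * v)) (at 0)"
      by (auto simp: has_field_derivative_def algebra_simps intro!: derivative_eq_intros)
    show ?thesis
      using local_max_second_derivative[OF e(1) 1 2] max[OF W'] by simp
  qed
  show "G z = 0" using dir[of 1] dir[of \<i>] by (simp add: complex_eq_iff)
  show "Re (wirt_zbar G z) \<le> 0" using dir[of 1] dir[of \<i>] by (simp add: wirt_zbar_def)
qed

text \<open>For a real function the zbar-derivative is the conjugate of the z-derivative, so the
  differential is a sum of two conjugate terms.\<close>

lemma has_derivative_real_valued:
  assumes W: "open W" "z \<in> W" and F: "F differentiable (at z)" and real: "\<And>w. w \<in> W \<Longrightarrow> Im (F w) = 0"
  shows "((\<lambda>w. Re (F w)) has_derivative (\<lambda>v. 2 * Re (wirt_z F z * v))) (at z)"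
proof -
  let ?D = "frechet_derivative F (at z)"
  have D: "(F has_derivative ?D) (at z)" using F by (simp add: frechet_derivative_works)
  \<comment> \<open>The imaginary part vanishes on a neighbourhood, so uniqueness of derivatives
    makes the differential of \<open>F\<close> real.\<close>
  have "((\<lambda>w. Im (F w)) has_derivative (\<lambda>v. Im (?D v))) (at z)"
    using D by (auto intro!: derivative_eq_intros)
  then have "((\<lambda>w. 0) has_derivative (\<lambda>v. Im (?D v))) (at z)"
    by (rule has_derivative_transform_within_open[OF _ W]) (use real in auto)
  then have D0: "(\<lambda>v. 0) = (\<lambda>v. Im (?D v))"
    by (rule has_derivative_unique[OF has_derivative_const])
  have im: "Im (?D v) = 0" for v using fun_cong[OF D0, of v] by simp
  have expand: "?D v = Re v *\<^sub>R ?D 1 + Im v *\<^sub>R ?D \<i>" for v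
  proof -
    have "?D (Re v *\<^sub>R 1 + Im v *\<^sub>R \<i>) = Re v *\<^sub>R ?D 1 + Im v *\<^sub>R ?D \<i>"
      using linear_frechet_derivative[OF F] by (simp only: linear_add linear_cmul)
    moreover have "Re v *\<^sub>R 1 + Im v *\<^sub>R \<i> = v" by (simp add: complex_eq_iff)
    ultimately show ?thesis by simp
  qed
  have "Re (?D v) = 2 * Re (wirt_z F z * v)" for v
    by (subst expand) (simp add: wirt_z_def im algebra_simps)
  moreover have "((\<lambda>w. Re (F w)) has_derivative (\<lambda>v. Re (?D v))) (at z)"
    using D by (auto intro!: derivative_eq_intros)
  ultimately show ?thesis by simp
qed

section \<open>Logarithmic derivatives of metric coefficients and of holomorphic functions\<close>

lemma smooth_on_C2:
  assumes "smooth_on F W" "z \<in> W"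
  shows "F differentiable (at z)" "(\<lambda>w. frechet_derivative F (at w) v) differentiable (at z)"
proof -
  have "Ck_on 2 F W" using assms(1) by (simp add: smooth_on_def)
  then show "F differentiable (at z)" "(\<lambda>w. frechet_derivative F (at w) v) differentiable (at z)"
    using assms(2) by (simp_all add: numeral_2_eq_2)
qed

text \<open>Locally the function is twice the real part of a logarithm of \<open>\<phi>\<close>.
  Computing with real and imaginary parts avoids the choice of a branch.\<close>

lemma has_derivative_ln_cmod:
  assumes "(\<phi> has_field_derivative d) (at z)" "\<phi> z \<noteq> 0"
  shows "((\<lambda>w. ln ((cmod (\<phi> w))\<^sup>2)) has_derivative (\<lambda>v. 2 * Re (d / \<phi> z * v))) (at z)"
proof -
  have n: "(cmod w)\<^sup>2 = (Re w)\<^sup>2 + (Im w)\<^sup>2" for w by (rule cmod_power2)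
  have 0: "(Re (\<phi> z))\<^sup>2 + (Im (\<phi> z))\<^sup>2 > 0" using assms(2) by (simp add: complex_neq_0)
  have D: "(\<phi> has_derivative (*) d) (at z)" using assms(1) by (simp add: has_field_derivative_def)
  have "((\<lambda>w. ln ((cmod (\<phi> w))\<^sup>2)) has_derivative
      (\<lambda>v. (2 * Re (\<phi> z) * Re (d * v) + 2 * Im (\<phi> z) * Im (d * v)) / ((Re (\<phi> z))\<^sup>2 + (Im (\<phi> z))\<^sup>2))) (at z)"
    unfolding n
    by (rule has_derivative_eq_rhs, rule has_derivative_ln[where g = "\<lambda>w. (Re (\<phi> w))\<^sup>2 + (Im (\<phi> w))\<^sup>2", OF 0])
      (use D in \<open>auto intro!: derivative_eq_intros simp: divide_inverse algebra_simps\<close>)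
  moreover have "(2 * Re (\<phi> z) * Re (d * v) + 2 * Im (\<phi> z) * Im (d * v)) / ((Re (\<phi> z))\<^sup>2 + (Im (\<phi> z))\<^sup>2)
     = 2 * Re (d / \<phi> z * v)" for v
  proof -
    have "d / \<phi> z * v = (d * v * cnj (\<phi> z)) / of_real ((Re (\<phi> z))\<^sup>2 + (Im (\<phi> z))\<^sup>2)"
      by (simp add: complex_div_cnj[of d] n flip: of_real_power of_real_add)
    then have "2 * Re (d / \<phi> z * v) = 2 * Re (d * v * cnj (\<phi> z)) / ((Re (\<phi> z))\<^sup>2 + (Im (\<phi> z))\<^sup>2)"
      by (simp only: Re_divide_of_real times_divide_eq_right)
    then show ?thesis by (simp add: algebra_simps)
  qed
  ultimately show ?thesis by simp
qed

text \<open>Intended for the metric coefficients \<open>P\<close>, \<open>Q\<close> of E1, E2 and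
  the coefficient \<open>\<phi>\<close> of \<Phi>: the argument of the logarithm is then |\<Phi>|^2
  and \<open>G\<close> is the z-derivative of its logarithm. Under a further zbar-derivative the
  holomorphic term drops out and the difference of the curvatures remains, up to sign.\<close>

lemma log_ratio_wirtinger:
  fixes P Q \<phi> :: "complex \<Rightarrow> complex"
  assumes W: "open W"
    and P: "smooth_on P W" "\<And>w. w \<in> W \<Longrightarrow> Im (P w) = 0" "\<And>w. w \<in> W \<Longrightarrow> Re (P w) > 0"
    and Q: "smooth_on Q W" "\<And>w. w \<in> W \<Longrightarrow> Im (Q w) = 0" "\<And>w. w \<in> W \<Longrightarrow> Re (Q w) > 0"
    and \<phi>: "\<phi> holomorphic_on W" "\<And>w. w \<in> W \<Longrightarrow> \<phi> w \<noteq> 0"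
    and z: "z \<in> W"
  defines "G \<equiv> \<lambda>w. wirt_z P w / P w - wirt_z Q w / Q w + deriv \<phi> w / \<phi> w"
  shows "((\<lambda>w. ln (Re (P w) * (cmod (\<phi> w))\<^sup>2 / Re (Q w))) has_derivative (\<lambda>v. 2 * Re (G z * v))) (at z)"
    and "G differentiable (at z)"
    and "wirt_zbar G z
      = wirt_zbar (\<lambda>w. wirt_z P w / P w) z - wirt_zbar (\<lambda>w. wirt_z Q w / Q w) z"
proof -
  have ln_real: "((\<lambda>w. ln (Re (H w))) has_derivative (\<lambda>v. 2 * Re (wirt_z H z / H z * v))) (at z)"
    if H: "smooth_on H W" "\<And>w. w \<in> W \<Longrightarrow> Im (H w) = 0" "\<And>w. w \<in> W \<Longrightarrow> Re (H w) > 0" for H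
  proof -
    have "((\<lambda>w. ln (Re (H w))) has_derivative (\<lambda>v. 2 * Re (wirt_z H z * v) * inverse (Re (H z)))) (at z)"
      by (rule has_derivative_ln[OF _ has_derivative_real_valued[OF W z]])
        (use H z smooth_on_C2 in auto)
    moreover have "H z = of_real (Re (H z))" using H(2)[OF z] by (simp add: complex_eq_iff)
    then have "Re (wirt_z H z / H z * v) = Re (wirt_z H z * v) * inverse (Re (H z))" for v
      by (metis Re_divide_of_real divide_inverse times_divide_eq_left)
    then have "2 * Re (wirt_z H z * v) * inverse (Re (H z)) = 2 * Re (wirt_z H z / H z * v)" for v
      by (simp only: mult.assoc)
    ultimately show ?thesis by (simp only:)
  qed
  have diff: "(\<lambda>w. wirt_z H w / H w) differentiable (at z)"
    if H: "smooth_on H W" "\<And>w. w \<in> W \<Longrightarrow> Re (H w) > 0" for H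
  proof -
    have "H z \<noteq> 0" using H(2)[OF z] by auto
    moreover have "(\<lambda>w. wirt_z H w) differentiable (at z)"
      unfolding wirt_z_def divide_inverse
      by (intro differentiable_mult differentiable_diff differentiable_const smooth_on_C2[OF H(1) z])
    ultimately show ?thesis
      unfolding divide_inverse
      by (intro differentiable_mult differentiable_inverse smooth_on_C2[OF H(1) z])
  qed
  have hol: "(\<lambda>w. deriv \<phi> w / \<phi> w) holomorphic_on W"
    using \<phi> W by (intro holomorphic_intros) auto
  then have hdiff: "(\<lambda>w. deriv \<phi> w / \<phi> w) differentiable (at z)"
    using W z holomorphic_on_imp_differentiable_at field_differentiable_imp_differentiable by blast
  show "G differentiable (at z)"
    unfolding G_def by (intro differentiable_add differentiable_diff diff hdiff P Q)
  have L: "((\<lambda>w. ln (Re (P w)) + ln ((cmod (\<phi> w))\<^sup>2) - ln (Re (Q w))) has_derivative (\<lambda>v. 2 * Re (G z * v))) (at z)"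
  proof (rule has_derivative_eq_rhs)
    show "((\<lambda>w. ln (Re (P w)) + ln ((cmod (\<phi> w))\<^sup>2) - ln (Re (Q w))) has_derivative
      (\<lambda>v. 2 * Re (wirt_z P z / P z * v) + 2 * Re (deriv \<phi> z / \<phi> z * v) - 2 * Re (wirt_z Q z / Q z * v))) (at z)"
      by (intro has_derivative_add has_derivative_diff ln_real P Q has_derivative_ln_cmod
          holomorphic_derivI[OF \<phi>(1) W z] \<phi>(2) z)
  qed (simp add: G_def algebra_simps)
  show "((\<lambda>w. ln (Re (P w) * (cmod (\<phi> w))\<^sup>2 / Re (Q w))) has_derivative (\<lambda>v. 2 * Re (G z * v))) (at z)"
  proof (rule has_derivative_transform_within_open[OF L W z])
    fix w assume "w \<in> W"
    then show "ln (Re (P w)) + ln ((cmod (\<phi> w))\<^sup>2) - ln (Re (Q w)) = ln (Re (P w) * (cmod (\<phi> w))\<^sup>2 / Re (Q w))"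
      using P(3)[of w] Q(3)[of w] \<phi>(2)[of w] by (simp add: ln_mult ln_div)
  qed
  \<comment> \<open>The sum is rewritten as a difference to fit
    \<open>wirt_zbar_diff\<close>.\<close>
  have "G = (\<lambda>w. (wirt_z P w / P w - wirt_z Q w / Q w) - - (deriv \<phi> w / \<phi> w))"
    by (simp add: G_def)
  then have "wirt_zbar G z = wirt_zbar (\<lambda>w. wirt_z P w / P w - wirt_z Q w / Q w) z
      - wirt_zbar (\<lambda>w. - (deriv \<phi> w / \<phi> w)) z"
    by (simp only:) (intro wirt_zbar_diff differentiable_diff differentiable_minus diff hdiff P Q)
  moreover have "wirt_zbar (\<lambda>w. - (deriv \<phi> w / \<phi> w)) z = 0"
    by (rule wirt_zbar_holomorphic[OF _ W z]) (intro holomorphic_on_minus hol)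
  ultimately show "wirt_zbar G z
      = wirt_zbar (\<lambda>w. wirt_z P w / P w) z - wirt_zbar (\<lambda>w. wirt_z Q w / Q w) z"
    using wirt_zbar_diff[OF diff[OF P(1,3)] diff[OF Q(1,3)]] by simp
qed

section \<open>Maps of class C^k on open sets\<close>

lemma Ck_on_cong:
  assumes "open S" "\<And>x. x \<in> S \<Longrightarrow> f x = g x"
  shows "Ck_on k f S \<longleftrightarrow> Ck_on k g S"
  using assms(2)
proof (induction k arbitrary: f g)
  case 0
  then show ?case by (simp cong: continuous_on_cong)
next
  case (Suc k)
  have D: "(f has_derivative d) (at x) \<longleftrightarrow> (g has_derivative d) (at x)" if "x \<in> S" for d x
    by (rule has_derivative_cong_open[OF assms(1) that Suc.prems])
  have "frechet_derivative f (at x) = frechet_derivative g (at x)" if "x \<in> S" for x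
    by (rule frechet_derivative_cong_open[OF assms(1) that Suc.prems])
  then have "Ck_on k (\<lambda>x. frechet_derivative f (at x) v) S \<longleftrightarrow> Ck_on k (\<lambda>x. frechet_derivative g (at x) v) S" for v
    by (intro Suc.IH) simp
  with D show ?case by (auto simp: differentiable_def)
qed

lemma smooth_on_cong:
  "open S \<Longrightarrow> (\<And>x. x \<in> S \<Longrightarrow> f x = g x) \<Longrightarrow> smooth_on f S \<longleftrightarrow> smooth_on g S"
  using Ck_on_cong[of S f g] by (simp add: smooth_on_def)

lemma smooth_on_subset: "smooth_on f S \<Longrightarrow> T \<subseteq> S \<Longrightarrow> smooth_on f T"
proof -
  have "Ck_on k f S \<Longrightarrow> T \<subseteq> S \<Longrightarrow> Ck_on k f T" for k
    by (induction k arbitrary: f) (auto intro: continuous_on_subset)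
  then show "smooth_on f S \<Longrightarrow> T \<subseteq> S \<Longrightarrow> smooth_on f T" by (simp add: smooth_on_def)
qed

text \<open>Used to pass from the smooth matrix of a Hermitian metric to its entries. The induction
  closes because differentiating commutes with \<open>l\<close>.\<close>

lemma smooth_on_bounded_linear:
  assumes l: "bounded_linear l" and S: "open S" and f: "smooth_on f S"
  shows "smooth_on (\<lambda>x. l (f x)) S"
proof -
  have "Ck_on k (\<lambda>x. l (f x)) S" if "Ck_on k f S" for k
    using that
  proof (induction k arbitrary: f)
    case 0
    then show ?case by (auto intro: bounded_linear.continuous_on[OF l])
  next
    case (Suc k)
    have D: "((\<lambda>x. l (f x)) has_derivative (\<lambda>v. l (frechet_derivative f (at x) v))) (at x)" if "x \<in> S" for x
      using Suc.prems that by (intro bounded_linear.has_derivative[OF l]) (simp add: frechet_derivative_works)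
    have "Ck_on k (\<lambda>x. l (frechet_derivative f (at x) v)) S" for v
      using Suc by simp
    moreover have "l (frechet_derivative f (at x) v) = frechet_derivative (\<lambda>x. l (f x)) (at x) v"
      if "x \<in> S" for x v
      using fun_cong[OF frechet_derivative_at[OF D[OF that]]] .
    ultimately have "Ck_on k (\<lambda>x. frechet_derivative (\<lambda>x. l (f x)) (at x) v) S" for v
      using Ck_on_cong[OF S, of "\<lambda>x. l (frechet_derivative f (at x) v)"
          "\<lambda>x. frechet_derivative (\<lambda>x. l (f x)) (at x) v" k] by blast
    then show ?case using D by (auto simp: differentiable_def)
  qed
  then show ?thesis using f by (simp add: smooth_on_def)
qed

section \<open>Vortex triples of line bundles in coordinates\<close>

lemma chart_image:
  assumes "riemann_surface \<A>" "c \<in> \<A>"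
  shows "open (fst c)" "continuous_on (fst c) (snd c)"
    and "x \<in> fst c \<Longrightarrow> chart_inv c (snd c x) = x"
    and "open V \<Longrightarrow> open (snd c ` (fst c \<inter> V))"
proof -
  have h: "homeomorphism (fst c) (snd c ` fst c) (snd c) (chart_inv c)"
    and o: "open (snd c ` fst c)" and o1: "open (fst c)"
    using assms unfolding riemann_surface_def by blast+
  show "open (fst c)" by fact
  show "continuous_on (fst c) (snd c)" "x \<in> fst c \<Longrightarrow> chart_inv c (snd c x) = x"
    using h by (auto simp: homeomorphism_def)
  assume "open V"
  then have "openin (top_of_set (fst c)) (fst c \<inter> V)"
    by (simp add: openin_open_Int)
  then have "openin (top_of_set (snd c ` fst c)) (snd c ` (fst c \<inter> V))"
    using homeomorphism_imp_open_map[OF h] by blast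
  then show "open (snd c ` (fst c \<inter> V))"
    using o openin_open_trans by blast
qed

lemma lift_in_fibre:
  assumes "hol_vector_bundle \<A> E" "t \<in> trivs E" "x \<in> fst t"
  shows "proj E (lift E t x v) = x" "snd t (lift E t x v) = v"
proof -
  have "bij_betw (snd t) (proj E -` {x}) UNIV"
    using assms unfolding hol_vector_bundle_def by blast
  then have v: "v \<in> snd t ` (proj E -` {x})" by (simp add: bij_betw_def)
  show "proj E (lift E t x v) = x" using inv_into_into[OF v] by (simp add: lift_def)
  show "snd t (lift E t x v) = v" using f_inv_into_f[OF v] by (simp add: lift_def)
qed

lemma hdot_axis: "hdot (H *v axis j 1) (axis i 1) = H $ i $ j"
proof -
  have "hdot v (axis i 1) = v $ i" for v
    by (simp add: hdot_def axis_def if_distrib cong: if_cong)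
  then show ?thesis by (simp add: matrix_vector_mult_def axis_def if_distrib cong: if_cong)
qed

text \<open>\<open>hermitian_metric\<close> merely asserts that some smooth positive matrix
  represents \<open>h\<close>. Evaluating \<open>h\<close> on the frame vectors identifies that
  matrix with \<open>metric_matrix\<close>, which thus inherits its properties;
  \<open>hom_matrix_local\<close> plays the same part for sections.\<close>

lemma metric_matrix_local:
  assumes E: "hol_vector_bundle \<A> E" and h: "hermitian_metric \<A> E h" and t: "t \<in> trivs E"
  obtains H where "smooth_on_surface \<A> H (fst t)"
    "\<And>x. x \<in> fst t \<Longrightarrow> metric_matrix E h t x = H x"
    "\<And>x. x \<in> fst t \<Longrightarrow> positive_definite (H x)"
    "\<And>e e'. proj E e \<in> fst t \<Longrightarrow> proj E e' = proj E e \<Longrightarrow>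
       h e e' = hdot (H (proj E e) *v snd t e) (snd t e')"
proof -
  obtain H where H: "smooth_on_surface \<A> H (fst t)"
    "\<And>x. x \<in> fst t \<Longrightarrow> positive_definite (H x)"
    "\<And>e e'. proj E e \<in> fst t \<Longrightarrow> proj E e' = proj E e \<Longrightarrow>
       h e e' = hdot (H (proj E e) *v snd t e) (snd t e')"
    using h t unfolding hermitian_metric_def by meson
  have "metric_matrix E h t x = H x" if "x \<in> fst t" for x
    unfolding metric_matrix_def
    using lift_in_fibre[OF E t that] that by (subst vec_eq_iff) (simp add: H(3) hdot_axis)
  with H that show ?thesis by blast
qed

lemma metric_matrix_positive:
  assumes "hol_vector_bundle \<A> E" "hermitian_metric \<A> E h" "t \<in> trivs E" "x \<in> fst t"
  shows "positive_definite (metric_matrix E h t x)"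
  using metric_matrix_local[OF assms(1-3)] assms(4) by metis

lemma metric_matrix_inner:
  assumes "hol_vector_bundle \<A> E" "hermitian_metric \<A> E h" "t \<in> trivs E"
    "proj E e \<in> fst t" "proj E e' = proj E e"
  shows "h e e' = hdot (metric_matrix E h t (proj E e) *v snd t e) (snd t e')"
  using metric_matrix_local[OF assms(1-3)] assms(4,5) by metis

lemma metric_matrix_smooth:
  fixes E :: "('a::t2_space, 'e, 'n::finite) vbundle"
  assumes \<A>: "riemann_surface \<A>" "c \<in> \<A>"
    and E: "hol_vector_bundle \<A> E" "hermitian_metric \<A> E h" "t \<in> trivs E"
  shows "smooth_on (\<lambda>z. metric_matrix E h t (chart_inv c z) $ i $ j) (snd c ` (fst c \<inter> fst t))"
proof -
  let ?W = "snd c ` (fst c \<inter> fst t)"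
  obtain H where H: "smooth_on_surface \<A> H (fst t)" "\<And>x. x \<in> fst t \<Longrightarrow> metric_matrix E h t x = H x"
    using metric_matrix_local[OF E] by metis
  have "open (fst t)" using E unfolding hol_vector_bundle_def by blast
  then have W: "open ?W" by (rule chart_image[OF \<A>])
  have "smooth_on (\<lambda>z. H (chart_inv c z)) ?W"
    using H(1) \<A>(2) by (simp add: smooth_on_surface_def o_def)
  moreover have "bounded_linear (\<lambda>M :: complex ^ 'n ^ 'n. M $ i $ j)"
    using bounded_linear_compose[OF bounded_linear_vec_nth bounded_linear_vec_nth] .
  ultimately have "smooth_on (\<lambda>z. H (chart_inv c z) $ i $ j) ?W"
    using smooth_on_bounded_linear[OF _ W] by blast
  moreover have "metric_matrix E h t (chart_inv c z) $ i $ j = H (chart_inv c z) $ i $ j" if "z \<in> ?W" for z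
  proof -
    have "chart_inv c z \<in> fst t" using that chart_image(3)[OF \<A>] by auto
    then show ?thesis by (simp only: H(2))
  qed
  ultimately show ?thesis
    using smooth_on_cong[OF W, of "\<lambda>z. metric_matrix E h t (chart_inv c z) $ i $ j"
        "\<lambda>z. H (chart_inv c z) $ i $ j"] by simp
qed

lemma hom_matrix_local:
  assumes E: "hol_vector_bundle \<A> E" and \<Phi>: "hol_hom_section \<A> E E' \<Phi>"
    and t: "t \<in> trivs E" "t' \<in> trivs E'"
  obtains M where "hol_matrix_on_surface \<A> M (fst t \<inter> fst t')"
    "\<And>x. x \<in> fst t \<inter> fst t' \<Longrightarrow> hom_matrix E t t' \<Phi> x = M x"
    "\<And>e. proj E e \<in> fst t \<inter> fst t' \<Longrightarrow> snd t' (\<Phi> e) = M (proj E e) *v snd t e"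
proof -
  obtain M where M: "hol_matrix_on_surface \<A> M (fst t \<inter> fst t')"
    "\<And>e. proj E e \<in> fst t \<inter> fst t' \<Longrightarrow> snd t' (\<Phi> e) = M (proj E e) *v snd t e"
    using \<Phi> t unfolding hol_hom_section_def by meson
  have "hom_matrix E t t' \<Phi> x = M x" if "x \<in> fst t \<inter> fst t'" for x
    using lift_in_fibre[OF E t(1), of x] that by (simp add: hom_matrix_def M(2) matrix_of_matrix_vector_mul)
  with M that show ?thesis by blast
qed

lemma hom_matrix_apply:
  assumes "hol_vector_bundle \<A> E" "hol_hom_section \<A> E E' \<Phi>" "t \<in> trivs E" "t' \<in> trivs E'"
    "proj E e \<in> fst t \<inter> fst t'"
  shows "snd t' (\<Phi> e) = hom_matrix E t t' \<Phi> (proj E e) *v snd t e"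
  using hom_matrix_local[OF assms(1-4)] assms(5) by metis

lemma hom_matrix_holomorphic:
  assumes \<A>: "riemann_surface \<A>" "c \<in> \<A>"
    and E: "hol_vector_bundle \<A> E" "hol_hom_section \<A> E E' \<Phi>" "t \<in> trivs E" "t' \<in> trivs E'"
  shows "(\<lambda>z. hom_matrix E t t' \<Phi> (chart_inv c z) $ i $ j) holomorphic_on snd c ` (fst c \<inter> (fst t \<inter> fst t'))"
proof -
  let ?W = "snd c ` (fst c \<inter> (fst t \<inter> fst t'))"
  obtain M where M: "hol_matrix_on_surface \<A> M (fst t \<inter> fst t')"
    "\<And>x. x \<in> fst t \<inter> fst t' \<Longrightarrow> hom_matrix E t t' \<Phi> x = M x"
    using hom_matrix_local[OF E] by metis
  have "(\<lambda>z. M (chart_inv c z) $ i $ j) holomorphic_on ?W"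
    using M(1) \<A>(2) by (simp add: hol_matrix_on_surface_def hol_on_surface_def o_def)
  moreover have "hom_matrix E t t' \<Phi> (chart_inv c z) $ i $ j = M (chart_inv c z) $ i $ j" if "z \<in> ?W" for z
    using that M(2) chart_image(3)[OF \<A>] by auto
  ultimately show ?thesis by (simp cong: holomorphic_cong)
qed

section \<open>Matrices of size one\<close>

lemma all_singleton_UNIV: "UNIV = {a} \<Longrightarrow> (\<forall>i. R i) \<longleftrightarrow> R a"
  by (metis UNIV_I singletonD)

lemma matrix_eq_1x1:
  assumes "UNIV = {a :: 'n}" "UNIV = {b :: 'm}"
  shows "(M :: 'f ^ 'm ^ 'n) = N \<longleftrightarrow> M $ a $ b = N $ a $ b"
  by (simp add: vec_eq_iff all_singleton_UNIV[OF assms(1)] all_singleton_UNIV[OF assms(2)])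

lemma positive_definite_1x1:
  assumes "UNIV = {a :: 'n}"
  shows "positive_definite (M :: complex ^ 'n ^ 'n) \<longleftrightarrow> Im (M $ a $ a) = 0 \<and> Re (M $ a $ a) > 0"
proof -
  have all: "i = a" for i :: 'n using assms by blast
  have ct: "ctranspose M = M \<longleftrightarrow> Im (M $ a $ a) = 0"
    by (simp add: matrix_eq_1x1[OF assms assms] ctranspose_def complex_eq_iff)
  have h: "hdot (M *v v) v = M $ a $ a * of_real ((cmod (v $ a))\<^sup>2)" for v
    by (simp add: hdot_def matrix_vector_mult_def assms complex_norm_square mult.assoc del: of_real_power)
  have "(\<forall>v. v \<noteq> 0 \<longrightarrow> 0 < Re (hdot (M *v v) v)) \<longleftrightarrow> Re (M $ a $ a) > 0"
  proof
    assume "\<forall>v. v \<noteq> 0 \<longrightarrow> 0 < Re (hdot (M *v v) v)"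
    from this[rule_format, of "axis a 1"] show "Re (M $ a $ a) > 0"
      by (simp add: h axis_eq_0_iff)
  next
    assume *: "Re (M $ a $ a) > 0"
    have "v $ a \<noteq> 0" if "v \<noteq> 0" for v :: "complex ^ 'n"
      using that by (metis all vec_eq_iff zero_index)
    then show "\<forall>v. v \<noteq> 0 \<longrightarrow> 0 < Re (hdot (M *v v) v)"
      using * by (simp add: h)
  qed
  with ct show ?thesis by (simp add: positive_definite_def)
qed

text \<open>Ranks are cardinalities of index types, so rank one is expressed by naming the only
  index, \<open>a\<close> for E1 and \<open>b\<close> for E2. With a chart and two trivialisations
  fixed, every matrix in the equations reduces to one scalar function of the coordinate.\<close>

locale line_frame =
  fixes \<A> :: "('a::t2_space) chart set" and g :: "'a chart \<Rightarrow> 'a \<Rightarrow> real"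
    and E1 :: "('a, 'e1, 'n::finite) vbundle" and E2 :: "('a, 'e2, 'm::finite) vbundle"
    and \<Phi> :: "'e2 \<Rightarrow> 'e1" and h1 :: "'e1 \<Rightarrow> 'e1 \<Rightarrow> complex" and h2 :: "'e2 \<Rightarrow> 'e2 \<Rightarrow> complex"
    and a :: 'n and b :: 'm and c :: "'a chart" and t1 :: "('a, 'e1, 'n) triv" and t2 :: "('a, 'e2, 'm) triv"
  assumes surface: "riemann_surface \<A>" and kaehler: "kaehler_form \<A> g"
    and triple: "vortex_triple \<A> E1 E2 \<Phi>"
    and metric1: "hermitian_metric \<A> E1 h1" and metric2: "hermitian_metric \<A> E2 h2"
    and rank1: "UNIV = {a}" and rank2: "UNIV = {b}"
    and c: "c \<in> \<A>" and t1: "t1 \<in> trivs E1" and t2: "t2 \<in> trivs E2"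
begin

definition U :: "'a set" where "U = fst c \<inter> fst t1 \<inter> fst t2"
definition W :: "complex set" where "W = snd c ` U"
definition P :: "complex \<Rightarrow> complex" where "P z = metric_matrix E1 h1 t1 (chart_inv c z) $ a $ a"
definition Q :: "complex \<Rightarrow> complex" where "Q z = metric_matrix E2 h2 t2 (chart_inv c z) $ b $ b"
definition \<phi> :: "complex \<Rightarrow> complex" where "\<phi> z = hom_matrix E2 t2 t1 \<Phi> (chart_inv c z) $ a $ b"
text \<open>|\<Phi>|^2 in the coordinate.\<close>

definition N :: "complex \<Rightarrow> real" where "N z = Re (P z) * (cmod (\<phi> z))\<^sup>2 / Re (Q z)"
text \<open>The mixed derivative dbar d of log P; up to sign and the factor \<open>g\<close> it is
  the contracted curvature of E1. \<open>K2\<close> is its analogue for E2.\<close>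

definition K1 :: "complex \<Rightarrow> complex" where "K1 = wirt_zbar (\<lambda>w. wirt_z P w / P w)"
definition K2 :: "complex \<Rightarrow> complex" where "K2 = wirt_zbar (\<lambda>w. wirt_z Q w / Q w)"
text \<open>The z-derivative of log |\<Phi>|^2 wherever \<Phi> does not vanish.\<close>

definition G :: "complex \<Rightarrow> complex" where
  "G z = wirt_z P z / P z - wirt_z Q z / Q z + deriv \<phi> z / \<phi> z"

lemma bundle1: "hol_vector_bundle \<A> E1" and bundle2: "hol_vector_bundle \<A> E2"
  and hom_section: "hol_hom_section \<A> E2 E1 \<Phi>"
  using triple by (simp_all add: vortex_triple_def)

lemma open_U: "open U" and open_W: "open W"
proof -
  have o: "open (fst t1)" "open (fst t2)"
    using bundle1 bundle2 t1 t2 unfolding hol_vector_bundle_def by blast+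
  then show "open U" using chart_image(1)[OF surface c] by (auto simp: U_def)
  show "open W" using chart_image(4)[OF surface c open_Int[OF o]] by (simp add: W_def U_def Int_assoc)
qed

lemma chart_inv_U: "x \<in> U \<Longrightarrow> chart_inv c (snd c x) = x"
  and chart_inv_W: "z \<in> W \<Longrightarrow> chart_inv c z \<in> U"
  and snd_chart_inv_W: "z \<in> W \<Longrightarrow> snd c (chart_inv c z) = z"
  using chart_image(3)[OF surface c] by (auto simp: W_def U_def)

lemma in_W: "x \<in> U \<Longrightarrow> snd c x \<in> W"
  by (simp add: W_def)

lemma g_pos: "x \<in> U \<Longrightarrow> g c x > 0"
  using kaehler c unfolding kaehler_form_def U_def by blast

lemma P_pos: "z \<in> W \<Longrightarrow> Im (P z) = 0" "z \<in> W \<Longrightarrow> Re (P z) > 0"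
  and Q_pos: "z \<in> W \<Longrightarrow> Im (Q z) = 0" "z \<in> W \<Longrightarrow> Re (Q z) > 0"
  using metric_matrix_positive[OF bundle1 metric1 t1] metric_matrix_positive[OF bundle2 metric2 t2]
    chart_inv_W unfolding positive_definite_1x1[OF rank1] positive_definite_1x1[OF rank2]
  by (auto simp: P_def Q_def U_def)

lemma P_real: "z \<in> W \<Longrightarrow> P z = of_real (Re (P z))"
  and Q_real: "z \<in> W \<Longrightarrow> Q z = of_real (Re (Q z))"
  by (simp_all add: complex_eq_iff P_pos Q_pos)

lemma smooth_P: "smooth_on P W" and smooth_Q: "smooth_on Q W" and hol_\<phi>: "\<phi> holomorphic_on W"
proof -
  have "smooth_on P (snd c ` (fst c \<inter> fst t1))" "smooth_on Q (snd c ` (fst c \<inter> fst t2))"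
    unfolding P_def Q_def
    by (intro metric_matrix_smooth[OF surface c] bundle1 bundle2 metric1 metric2 t1 t2)+
  then show "smooth_on P W" "smooth_on Q W"
    by (auto elim!: smooth_on_subset simp: W_def U_def)
  have "\<phi> holomorphic_on snd c ` (fst c \<inter> (fst t2 \<inter> fst t1))"
    unfolding \<phi>_def by (rule hom_matrix_holomorphic[OF surface c bundle2 hom_section t2 t1])
  then show "\<phi> holomorphic_on W"
    by (simp add: W_def U_def Int_ac)
qed

lemma chern_connection_entries:
  assumes "z \<in> W"
  shows "chern_connection E1 h1 c t1 (chart_inv c z) $ a $ a = wirt_z P z / P z"
    and "chern_connection E2 h2 c t2 (chart_inv c z) $ b $ b = wirt_z Q z / Q z"
proof -
  let ?x = "chart_inv c z"
  have m: "metric_matrix E1 h1 t1 ?x $ a $ a = P z" "metric_matrix E2 h2 t2 ?x $ b $ b = Q z"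
    by (simp_all add: P_def Q_def)
  have nz: "P z \<noteq> 0" "Q z \<noteq> 0" using P_pos[OF assms] Q_pos[OF assms] by auto
  have d: "mat_d_z c (metric_matrix E1 h1 t1) ?x $ a $ a = wirt_z P z"
    "mat_d_z c (metric_matrix E2 h2 t2) ?x $ b $ b = wirt_z Q z"
    by (simp_all add: mat_d_z_def d_z_def wirt_z_def o_def Let_def snd_chart_inv_W[OF assms] P_def[abs_def] Q_def[abs_def])
  show "chern_connection E1 h1 c t1 ?x $ a $ a = wirt_z P z / P z"
    using nz by (simp add: chern_connection_def matrix_matrix_mult_def rank1 matrix_inv_1x1[OF rank1] m d divide_inverse)
  show "chern_connection E2 h2 c t2 ?x $ b $ b = wirt_z Q z / Q z"
    using nz by (simp add: chern_connection_def matrix_matrix_mult_def rank2 matrix_inv_1x1[OF rank2] m d divide_inverse)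
qed

lemma i_Lambda_F_entries:
  assumes x: "x \<in> U"
  shows "i_Lambda_F g E1 h1 c t1 x $ a $ a = - K1 (snd c x) / g c x"
    and "i_Lambda_F g E2 h2 c t2 x $ b $ b = - K2 (snd c x) / g c x"
proof -
  \<comment> \<open>The connection entries are known to be the logarithmic derivatives only on
    \<open>W\<close>; since \<open>W\<close> is open, this determines their derivatives.\<close>
  have "K1 (snd c x) = wirt_zbar (\<lambda>z. chern_connection E1 h1 c t1 (chart_inv c z) $ a $ a) (snd c x)"
    "K2 (snd c x) = wirt_zbar (\<lambda>z. chern_connection E2 h2 c t2 (chart_inv c z) $ b $ b) (snd c x)"
    unfolding K1_def K2_def wirt_zbar_def
    by (subst frechet_derivative_cong_open[OF open_W in_W[OF x]]; simp add: chern_connection_entries)+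
  then have "chern_curvature E1 h1 c t1 x $ a $ a = - K1 (snd c x)"
    "chern_curvature E2 h2 c t2 x $ b $ b = - K2 (snd c x)"
    by (simp_all add: chern_curvature_def mat_d_zbar_def d_zbar_def wirt_zbar_def o_def Let_def)
  then show "i_Lambda_F g E1 h1 c t1 x $ a $ a = - K1 (snd c x) / g c x"
    "i_Lambda_F g E2 h2 c t2 x $ b $ b = - K2 (snd c x) / g c x"
    by (simp_all add: i_Lambda_F_def) (simp_all add: scaleR_conv_of_real)
qed

text \<open>\<open>M\<close> is left arbitrary so that the same computation serves \<Phi> and its
  covariant derivative.\<close>

lemma hom_adjoint_entry:
  assumes x: "x \<in> U"
  shows "(M ** hom_adjoint (metric_matrix E1 h1 t1 x) (metric_matrix E2 h2 t2 x) M) $ a $ a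
    = of_real (Re (P (snd c x)) * (cmod (M $ a $ b))\<^sup>2 / Re (Q (snd c x)))"
proof -
  have m: "metric_matrix E1 h1 t1 x $ a $ a = P (snd c x)" "metric_matrix E2 h2 t2 x $ b $ b = Q (snd c x)"
    using chart_inv_U[OF x] by (simp_all add: P_def Q_def)
  have "Q (snd c x) \<noteq> 0" using Q_pos[OF in_W[OF x]] by auto
  then have "(M ** hom_adjoint (metric_matrix E1 h1 t1 x) (metric_matrix E2 h2 t2 x) M) $ a $ a
    = M $ a $ b * (inverse (Q (snd c x)) * cnj (M $ a $ b) * P (snd c x))"
    by (simp add: hom_adjoint_def ctranspose_def matrix_matrix_mult_def rank1 rank2 m matrix_inv_1x1[OF rank2])
  also have "\<dots> = of_real (Re (P (snd c x))) * (M $ a $ b * cnj (M $ a $ b)) / of_real (Re (Q (snd c x)))"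
    using P_real[OF in_W[OF x]] Q_real[OF in_W[OF x]] by (simp add: divide_inverse mult_ac)
  finally show ?thesis by (simp flip: complex_norm_square)
qed

lemma Phi_entries:
  assumes x: "x \<in> U"
  shows "Phi_Phi_adj E1 E2 \<Phi> h1 h2 t1 t2 x $ a $ a = of_real (N (snd c x))"
    and "norm2_Phi E1 E2 \<Phi> h1 h2 t1 t2 x = N (snd c x)"
proof -
  show 1: "Phi_Phi_adj E1 E2 \<Phi> h1 h2 t1 t2 x $ a $ a = of_real (N (snd c x))"
    unfolding Phi_Phi_adj_def Let_def hom_adjoint_entry[OF x] by (simp add: N_def \<phi>_def chart_inv_U[OF x])
  show "norm2_Phi E1 E2 \<Phi> h1 h2 t1 t2 x = N (snd c x)"
    by (simp add: norm2_Phi_def trace_def rank1 1)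
qed

text \<open>Factoring \<open>\<phi>\<close> out of the covariant derivative leaves exactly the
  logarithmic derivative \<open>G\<close>; the division by \<open>\<phi>\<close> is the reason for
  the second hypothesis.\<close>

lemma nabla_Phi_entries:
  assumes x: "x \<in> U" and nz: "\<phi> (snd c x) \<noteq> 0"
  shows "nabla_Phi_nabla_Phi_adj g E1 E2 \<Phi> h1 h2 c t1 t2 x $ a $ a
      = of_real (N (snd c x) * (cmod (G (snd c x)))\<^sup>2 / g c x)"
    and "norm2_nabla_Phi g E1 E2 \<Phi> h1 h2 c t1 t2 x = N (snd c x) * (cmod (G (snd c x)))\<^sup>2 / g c x"
proof -
  have "nabla_Phi E1 E2 \<Phi> h1 h2 c t1 t2 x $ a $ b
    = wirt_z \<phi> (snd c x) + wirt_z P (snd c x) / P (snd c x) * \<phi> (snd c x)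
      - \<phi> (snd c x) * (wirt_z Q (snd c x) / Q (snd c x))"
  proof -
    have "mat_d_z c (hom_matrix E2 t2 t1 \<Phi>) x $ a $ b = wirt_z \<phi> (snd c x)"
      by (simp add: mat_d_z_def d_z_def wirt_z_def o_def Let_def \<phi>_def[abs_def])
    then show ?thesis
      using chern_connection_entries[OF in_W[OF x]]
      by (simp add: nabla_Phi_def matrix_matrix_mult_def rank1 rank2 chart_inv_U[OF x] \<phi>_def)
  qed
  also have "\<dots> = \<phi> (snd c x) * G (snd c x)"
    using nz wirt_z_holomorphic[OF hol_\<phi> open_W in_W[OF x]] by (simp add: G_def algebra_simps)
  finally have n: "nabla_Phi E1 E2 \<Phi> h1 h2 c t1 t2 x $ a $ b = \<phi> (snd c x) * G (snd c x)" .
  show 1: "nabla_Phi_nabla_Phi_adj g E1 E2 \<Phi> h1 h2 c t1 t2 x $ a $ a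
      = of_real (N (snd c x) * (cmod (G (snd c x)))\<^sup>2 / g c x)"
    unfolding nabla_Phi_nabla_Phi_adj_def Let_def
    by (simp add: hom_adjoint_entry[OF x] n N_def norm_mult power_mult_distrib)
      (simp add: scaleR_conv_of_real mult_ac)
  show "norm2_nabla_Phi g E1 E2 \<Phi> h1 h2 c t1 t2 x = N (snd c x) * (cmod (G (snd c x)))\<^sup>2 / g c x"
    by (simp add: norm2_nabla_Phi_def trace_def rank1 1)
qed

lemma N_pos: "z \<in> W \<Longrightarrow> \<phi> z \<noteq> 0 \<Longrightarrow> N z > 0"
  using P_pos Q_pos by (simp add: N_def)

text \<open>Characterises |\<Phi>|^2 as a ratio of lengths in the fibres, which no longer mentions
  the frame.\<close>

lemma norm_quotient:
  assumes "proj E2 e \<in> fst c \<inter> fst t1 \<inter> fst t2"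
  shows "Re (h1 (\<Phi> e) (\<Phi> e)) = N (snd c (proj E2 e)) * Re (h2 e e)"
proof -
  let ?x = "proj E2 e"
  have x: "?x \<in> U" using assms by (simp add: U_def)
  have p: "proj E1 (\<Phi> e) = ?x" using hom_section by (simp add: hol_hom_section_def)
  have q: "hdot (H *v v) v = H $ i $ i * of_real ((cmod (v $ i))\<^sup>2)" if "UNIV = {i :: 'k}"
    for i :: "'k::finite" and v H
    by (simp add: hdot_def matrix_vector_mult_def that complex_norm_square mult.assoc del: of_real_power)
  have "h1 (\<Phi> e) (\<Phi> e) = P (snd c ?x) * of_real ((cmod (snd t1 (\<Phi> e) $ a))\<^sup>2)"
    using metric_matrix_inner[OF bundle1 metric1 t1, of "\<Phi> e" "\<Phi> e"] x
    by (simp add: p U_def q[OF rank1] P_def chart_image(3)[OF surface c])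
  moreover have "snd t1 (\<Phi> e) $ a = \<phi> (snd c ?x) * snd t2 e $ b"
    using hom_matrix_apply[OF bundle2 hom_section t2 t1, of e] x
    by (simp add: U_def matrix_vector_mult_def rank2 \<phi>_def chart_image(3)[OF surface c])
  moreover have "h2 e e = Q (snd c ?x) * of_real ((cmod (snd t2 e $ b))\<^sup>2)"
    using metric_matrix_inner[OF bundle2 metric2 t2, of e e] x
    by (simp add: U_def q[OF rank2] Q_def chart_image(3)[OF surface c])
  ultimately show ?thesis
    using Q_pos[OF in_W[OF x]] P_pos[OF in_W[OF x]] by (simp add: N_def norm_mult power_mult_distrib)
qed

end

section \<open>The vortex equations for line bundles\<close>

text \<open>Equation and constraint state that (1 + iA)(1 + iy) + n/2, rotated by -\<theta>, is
  positive when \<open>A\<close> is real. A curvature entry is a complex number at first; its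
  reality is extracted from \<open>im\<close>.\<close>

lemma calibrated_scalar:
  fixes A :: complex and c s y n :: real
  assumes cs: "c\<^sup>2 + s\<^sup>2 = 1" and s: "s > 0" and n: "n \<ge> 0"
    and eq: "of_real c * (A + of_real y) = of_real s * (1 - A * of_real y + of_real (n / 2))"
    and im: "Im (of_real c * (1 - A * of_real y + of_real (n / 2)) + of_real s * (A + of_real y)) = 0"
    and re: "Re (of_real c * (1 - A * of_real y + of_real (n / 2)) + of_real s * (A + of_real y)) > 0"
  shows "Im A = 0" "c + s * y > 0" "Re A * (c + s * y) = s - c * y + s * n / 2"
proof -
  let ?S = "of_real c * (1 - A * of_real y + of_real (n / 2)) + of_real s * (A + of_real y)"
  \<comment> \<open>Multiplying by \<open>s\<close> lets \<open>eq\<close> replace the real part by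
    the imaginary part, and c^2 + s^2 = 1 collapses the rest to A + y.\<close>
  have "of_real s * ?S = of_real c * (of_real s * (1 - A * of_real y + of_real (n / 2))) + of_real (s\<^sup>2) * (A + of_real y)"
    by (simp add: algebra_simps power2_eq_square)
  also have "\<dots> = of_real (c\<^sup>2 + s\<^sup>2) * (A + of_real y)"
    unfolding eq[symmetric] by (simp add: algebra_simps power2_eq_square)
  finally have S: "A + of_real y = of_real s * ?S" by (simp add: cs)
  have "Im (A + of_real y) = s * Im ?S" by (subst S) simp
  then have "Im (A + of_real y) = 0" unfolding im by simp
  then show "Im A = 0" by simp
  have "Re (A + of_real y) = s * Re ?S" by (subst S) simp
  then have "Re (A + of_real y) > 0" using mult_pos_pos[OF s re] by (simp only:)
  then have pos: "Re A + y > 0" by simp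
  have "c * (Re A + y) = s * (1 - Re A * y + n / 2)"
    using arg_cong[OF eq, of Re] by simp
  then show eq': "Re A * (c + s * y) = s - c * y + s * n / 2"
    by (simp add: algebra_simps)
  \<comment> \<open>Adding y(c + sy) to \<open>eq'\<close> cancels the terms with \<open>c\<close>
    and leaves a positive right side, so the two factors have the same sign.\<close>
  have "(Re A + y) * (c + s * y) = s * (1 + y\<^sup>2 + n / 2)"
    using eq' by (simp add: algebra_simps power2_eq_square)
  also have "\<dots> > 0" using s n by (simp add: add_pos_nonneg)
  finally show "c + s * y > 0" using pos by (simp add: zero_less_mult_iff)
qed

text \<open>The previous computation run backwards for n = 0; here \<open>f\<close> is tan(\<theta>
  - arctan y) when \<open>c\<close>, \<open>s\<close> are the cosine and sine of \<theta>.\<close>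

lemma calibrated_scalar_converse:
  fixes c s y f :: real
  assumes cs: "c\<^sup>2 + s\<^sup>2 = 1" and s: "s > 0" and pos: "c + s * y > 0"
  defines "f \<equiv> (s - c * y) / (c + s * y)"
  shows "c * (f + y) = s * (1 - f * y)" and "c * (1 - f * y) + s * (f + y) > 0"
proof -
  have "f * (c + s * y) = s - c * y" using pos by (simp add: f_def)
  then show eq: "c * (f + y) = s * (1 - f * y)" by (simp add: algebra_simps)
  have "(f + y) * (c + s * y) = s * (1 + y\<^sup>2)"
    using \<open>f * (c + s * y) = s - c * y\<close> by (simp add: algebra_simps power2_eq_square)
  also have "\<dots> > 0" using s by (simp add: add_pos_nonneg)
  finally have I: "f + y > 0" using pos by (simp add: zero_less_mult_iff)
  have "s * (c * (1 - f * y) + s * (f + y)) = c * (s * (1 - f * y)) + s\<^sup>2 * (f + y)"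
    by (simp add: algebra_simps power2_eq_square)
  also have "\<dots> = (c\<^sup>2 + s\<^sup>2) * (f + y)"
    unfolding eq[symmetric] by (simp add: algebra_simps power2_eq_square)
  finally show "c * (1 - f * y) + s * (f + y) > 0"
    using I cs s by (metis mult_1 zero_less_mult_pos)
qed

text \<open>\<open>y \<mapsto> (s - c y) / (c + s y)\<close> is a cotangent and hence strictly decreasing.\<close>

lemma cotangent_antimono:
  fixes c s y f \<alpha> \<beta> :: real
  assumes "c\<^sup>2 + s\<^sup>2 = 1" "c + s * f > 0" "c + s * y > 0"
    and "\<alpha> * (c + s * f) = s - c * f" "\<beta> * (c + s * y) = s - c * y" and "\<beta> \<le> \<alpha>"
  shows "f \<le> y"
proof -
  have "\<beta> * ((c + s * f) * (c + s * y)) \<le> \<alpha> * ((c + s * f) * (c + s * y))"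
    using assms(2,3,6) by (intro mult_right_mono) auto
  moreover have "\<beta> * ((c + s * f) * (c + s * y)) = (s - c * y) * (c + s * f)"
    unfolding assms(5)[symmetric] by (simp add: mult_ac)
  moreover have "\<alpha> * ((c + s * f) * (c + s * y)) = (s - c * f) * (c + s * y)"
    unfolding assms(4)[symmetric] by (simp add: mult_ac)
  \<comment> \<open>After cross-multiplication the terms cs and cs f y cancel from both
    sides.\<close>
  ultimately have "(c\<^sup>2 + s\<^sup>2) * f \<le> (c\<^sup>2 + s\<^sup>2) * y"
    by (simp add: algebra_simps power2_eq_square)
  then show ?thesis using assms(1) by simp
qed

section \<open>Reduction to scalars in a frame, and extrema of |\<Phi>|^2\<close>

context line_frame
begin

abbreviation "A_at x \<equiv> i_Lambda_F g E1 h1 c t1 x $ a $ a"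
abbreviation "B_at x \<equiv> i_Lambda_F g E2 h2 c t2 x $ b $ b"
abbreviation "norm_Phi \<equiv> norm2_Phi E1 E2 \<Phi> h1 h2 t1 t2"
abbreviation "norm_nabla \<equiv> norm2_nabla_Phi g E1 E2 \<Phi> h1 h2 c t1 t2"
abbreviation "Phi_at x \<equiv> hom_matrix E2 t2 t1 \<Phi> x $ a $ b"

text \<open>In rank one half the anticommutator is a plain product. Writing the E2 expressions with
  4 pi/\<sigma> - |\<Phi>|^2 gives them the same shape as those of E1, so that
  \<open>calibrated_scalar\<close> applies to both.\<close>

lemma vortex_entries:
  assumes x: "x \<in> U" and nz: "Phi_at x \<noteq> 0"
  shows "im_part1 g E1 E2 \<Phi> h1 h2 c t1 t2 x $ a $ a = A_at x + of_real (norm_Phi x)"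
    and "re_part1 g E1 E2 \<Phi> h1 h2 c t1 t2 x $ a $ a
      = 1 - A_at x * of_real (norm_Phi x) + of_real (norm_nabla x / 2)"
    and "im_part2 g E1 E2 \<Phi> h1 h2 \<sigma> c t1 t2 x $ b $ b = B_at x + of_real (4 * pi / \<sigma> - norm_Phi x)"
    and "re_part2 g E1 E2 \<Phi> h1 h2 \<sigma> c t1 t2 x $ b $ b
      = 1 - B_at x * of_real (4 * pi / \<sigma> - norm_Phi x) + of_real (norm_nabla x / 2)"
    and "norm_nabla x \<ge> 0"
proof -
  have nz': "\<phi> (snd c x) \<noteq> 0" using nz by (simp add: \<phi>_def chart_inv_U[OF x])
  note e = Phi_entries[OF x] nabla_Phi_entries[OF x nz']
  show "im_part1 g E1 E2 \<Phi> h1 h2 c t1 t2 x $ a $ a = A_at x + of_real (norm_Phi x)"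
    by (simp add: im_part1_def e)
  have "re_part1 g E1 E2 \<Phi> h1 h2 c t1 t2 x $ a $ a
      = 1 - (1/2) *\<^sub>R (A_at x * of_real (N (snd c x)) + of_real (N (snd c x)) * A_at x)
       + (1/2) *\<^sub>R of_real (norm_nabla x)"
    by (simp add: re_part1_def e anticomm_def matrix_matrix_mult_def rank1 mat_def)
  then show "re_part1 g E1 E2 \<Phi> h1 h2 c t1 t2 x $ a $ a
      = 1 - A_at x * of_real (norm_Phi x) + of_real (norm_nabla x / 2)"
    by (simp add: e(2) scaleR_conv_of_real)
  have "im_part2 g E1 E2 \<Phi> h1 h2 \<sigma> c t1 t2 x $ b $ b = B_at x + (4 * pi / \<sigma> - norm_Phi x) *\<^sub>R 1"
    by (simp add: im_part2_def mat_def)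
  then show "im_part2 g E1 E2 \<Phi> h1 h2 \<sigma> c t1 t2 x $ b $ b = B_at x + of_real (4 * pi / \<sigma> - norm_Phi x)"
    by (simp add: scaleR_conv_of_real)
  have "re_part2 g E1 E2 \<Phi> h1 h2 \<sigma> c t1 t2 x $ b $ b
      = 1 + (norm_Phi x - 4 * pi / \<sigma>) *\<^sub>R B_at x + (1/2 * norm_nabla x) *\<^sub>R 1"
    by (simp add: re_part2_def mat_def)
  then show "re_part2 g E1 E2 \<Phi> h1 h2 \<sigma> c t1 t2 x $ b $ b
      = 1 - B_at x * of_real (4 * pi / \<sigma> - norm_Phi x) + of_real (norm_nabla x / 2)"
    by (simp add: scaleR_conv_of_real algebra_simps)
  show "norm_nabla x \<ge> 0"
    using N_pos[OF in_W[OF x] nz'] g_pos[OF x] by (simp add: e)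
qed

lemma positive_endo_entries:
  assumes x: "x \<in> U"
  shows "positive_endo (metric_matrix E1 h1 t1 x) X \<longleftrightarrow> Im (X $ a $ a) = 0 \<and> Re (X $ a $ a) > 0"
    and "positive_endo (metric_matrix E2 h2 t2 x) Y \<longleftrightarrow> Im (Y $ b $ b) = 0 \<and> Re (Y $ b $ b) > 0"
proof -
  have "metric_matrix E1 h1 t1 x $ a $ a = of_real (Re (P (snd c x)))"
    "metric_matrix E2 h2 t2 x $ b $ b = of_real (Re (Q (snd c x)))"
    using P_real[OF in_W[OF x]] Q_real[OF in_W[OF x]] by (simp_all add: P_def Q_def chart_inv_U[OF x])
  then show "positive_endo (metric_matrix E1 h1 t1 x) X \<longleftrightarrow> Im (X $ a $ a) = 0 \<and> Re (X $ a $ a) > 0"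
    "positive_endo (metric_matrix E2 h2 t2 x) Y \<longleftrightarrow> Im (Y $ b $ b) = 0 \<and> Re (Y $ b $ b) > 0"
    using P_pos[OF in_W[OF x]] Q_pos[OF in_W[OF x]]
    by (auto simp: positive_endo_def positive_definite_1x1[OF rank1] positive_definite_1x1[OF rank2]
        matrix_matrix_mult_def rank1 rank2 zero_less_mult_iff)
qed

lemma vortex_scalars:
  assumes x: "x \<in> U" and nz: "Phi_at x \<noteq> 0" and s: "sin \<theta> > 0"
    and eq: "deformed_vortex_equations \<A> g E1 E2 \<Phi> h1 h2 \<sigma> \<theta>"
    and cal: "calibration_constraint \<A> g E1 E2 \<Phi> h1 h2 \<sigma> \<theta>"
  shows "Im (A_at x) = 0" "cos \<theta> + sin \<theta> * norm_Phi x > 0"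
    "Re (A_at x) * (cos \<theta> + sin \<theta> * norm_Phi x) = sin \<theta> - cos \<theta> * norm_Phi x + sin \<theta> * norm_nabla x / 2"
    and "Im (B_at x) = 0" "cos \<theta> + sin \<theta> * (4 * pi / \<sigma> - norm_Phi x) > 0"
    "Re (B_at x) * (cos \<theta> + sin \<theta> * (4 * pi / \<sigma> - norm_Phi x))
      = sin \<theta> - cos \<theta> * (4 * pi / \<sigma> - norm_Phi x) + sin \<theta> * norm_nabla x / 2"
proof -
  have x': "x \<in> fst c \<inter> fst t1 \<inter> fst t2" using x by (simp add: U_def)
  note ent = vortex_entries[OF x nz]
  have e1: "cos \<theta> *\<^sub>R im_part1 g E1 E2 \<Phi> h1 h2 c t1 t2 x = sin \<theta> *\<^sub>R re_part1 g E1 E2 \<Phi> h1 h2 c t1 t2 x"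
    and e2: "cos \<theta> *\<^sub>R im_part2 g E1 E2 \<Phi> h1 h2 \<sigma> c t1 t2 x = sin \<theta> *\<^sub>R re_part2 g E1 E2 \<Phi> h1 h2 \<sigma> c t1 t2 x"
    using eq c t1 t2 x' unfolding deformed_vortex_equations_def by blast+
  have p1: "positive_endo (metric_matrix E1 h1 t1 x) (cos \<theta> *\<^sub>R re_part1 g E1 E2 \<Phi> h1 h2 c t1 t2 x
           + sin \<theta> *\<^sub>R im_part1 g E1 E2 \<Phi> h1 h2 c t1 t2 x)"
    and p2: "positive_endo (metric_matrix E2 h2 t2 x) (cos \<theta> *\<^sub>R re_part2 g E1 E2 \<Phi> h1 h2 \<sigma> c t1 t2 x
           + sin \<theta> *\<^sub>R im_part2 g E1 E2 \<Phi> h1 h2 \<sigma> c t1 t2 x)"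
    using cal c t1 t2 x' unfolding calibration_constraint_def by blast+
  have cs: "(cos \<theta>)\<^sup>2 + (sin \<theta>)\<^sup>2 = 1" by simp
  note 1 = calibrated_scalar[OF cs s ent(5), of "A_at x" "norm_Phi x"]
  note 2 = calibrated_scalar[OF cs s ent(5), of "B_at x" "4 * pi / \<sigma> - norm_Phi x"]
  have a: "of_real (cos \<theta>) * (A_at x + of_real (norm_Phi x)) = of_real (sin \<theta>) * (1 - A_at x * of_real (norm_Phi x) + of_real (norm_nabla x / 2))"
    using arg_cong[OF e1, of "\<lambda>M. M $ a $ a"]
    unfolding vector_scaleR_component ent unfolding scaleR_conv_of_real .
  have b: "of_real (cos \<theta>) * (B_at x + of_real (4 * pi / \<sigma> - norm_Phi x)) = of_real (sin \<theta>) * (1 - B_at x * of_real (4 * pi / \<sigma> - norm_Phi x) + of_real (norm_nabla x / 2))"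
    using arg_cong[OF e2, of "\<lambda>M. M $ b $ b"]
    unfolding vector_scaleR_component ent unfolding scaleR_conv_of_real .
  note p1' = p1[unfolded positive_endo_entries[OF x] vector_add_component vector_scaleR_component ent, unfolded scaleR_conv_of_real]
  note p2' = p2[unfolded positive_endo_entries[OF x] vector_add_component vector_scaleR_component ent, unfolded scaleR_conv_of_real]
  show "Im (A_at x) = 0" "cos \<theta> + sin \<theta> * norm_Phi x > 0"
    "Re (A_at x) * (cos \<theta> + sin \<theta> * norm_Phi x) = sin \<theta> - cos \<theta> * norm_Phi x + sin \<theta> * norm_nabla x / 2"
    using 1[OF a] p1' by blast+
  show "Im (B_at x) = 0" "cos \<theta> + sin \<theta> * (4 * pi / \<sigma> - norm_Phi x) > 0"
    "Re (B_at x) * (cos \<theta> + sin \<theta> * (4 * pi / \<sigma> - norm_Phi x))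
      = sin \<theta> - cos \<theta> * (4 * pi / \<sigma> - norm_Phi x) + sin \<theta> * norm_nabla x / 2"
    using 2[OF b] p2' by blast+
qed

lemma constant_solution_at:
  assumes x: "x \<in> U" and nz: "Phi_at x \<noteq> 0" and s: "sin \<theta> > 0"
    and i: "cos \<theta> + 2 * pi / \<sigma> * sin \<theta> > 0"
    and f: "f = (sin \<theta> - 2 * pi / \<sigma> * cos \<theta>) / (cos \<theta> + 2 * pi / \<sigma> * sin \<theta>)"
    and A: "A_at x = of_real f" and B: "B_at x = of_real f"
    and N: "norm_Phi x = 2 * pi / \<sigma>" and n: "norm_nabla x = 0"
  shows "cos \<theta> *\<^sub>R im_part1 g E1 E2 \<Phi> h1 h2 c t1 t2 x = sin \<theta> *\<^sub>R re_part1 g E1 E2 \<Phi> h1 h2 c t1 t2 x"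
    "cos \<theta> *\<^sub>R im_part2 g E1 E2 \<Phi> h1 h2 \<sigma> c t1 t2 x = sin \<theta> *\<^sub>R re_part2 g E1 E2 \<Phi> h1 h2 \<sigma> c t1 t2 x"
    "positive_endo (metric_matrix E1 h1 t1 x) (cos \<theta> *\<^sub>R re_part1 g E1 E2 \<Phi> h1 h2 c t1 t2 x
           + sin \<theta> *\<^sub>R im_part1 g E1 E2 \<Phi> h1 h2 c t1 t2 x)"
    "positive_endo (metric_matrix E2 h2 t2 x) (cos \<theta> *\<^sub>R re_part2 g E1 E2 \<Phi> h1 h2 \<sigma> c t1 t2 x
           + sin \<theta> *\<^sub>R im_part2 g E1 E2 \<Phi> h1 h2 \<sigma> c t1 t2 x)"
proof -
  define y where "y = 2 * pi / \<sigma>"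
  \<comment> \<open>Because 2 pi/\<sigma> is fixed under y -> 4 pi/\<sigma> - y, the expressions for
    E1 and E2 coincide.\<close>
  have "4 * pi / \<sigma> - 2 * pi / \<sigma> = y" by (simp add: y_def field_simps)
  then have ent: "im_part1 g E1 E2 \<Phi> h1 h2 c t1 t2 x $ a $ a = of_real (f + y)"
    "re_part1 g E1 E2 \<Phi> h1 h2 c t1 t2 x $ a $ a = of_real (1 - f * y)"
    "im_part2 g E1 E2 \<Phi> h1 h2 \<sigma> c t1 t2 x $ b $ b = of_real (f + y)"
    "re_part2 g E1 E2 \<Phi> h1 h2 \<sigma> c t1 t2 x $ b $ b = of_real (1 - f * y)"
    using vortex_entries(1,2)[OF x nz] vortex_entries(3,4)[OF x nz, of \<sigma>] by (simp_all add: A B N n y_def)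
  have "f = (sin \<theta> - cos \<theta> * y) / (cos \<theta> + sin \<theta> * y)" using f by (simp add: y_def mult.commute)
  moreover have "cos \<theta> + sin \<theta> * y > 0" using i by (simp add: y_def mult.commute)
  ultimately have eq: "cos \<theta> * (f + y) = sin \<theta> * (1 - f * y)"
    and pos: "cos \<theta> * (1 - f * y) + sin \<theta> * (f + y) > 0"
    using calibrated_scalar_converse[of "cos \<theta>" "sin \<theta>" y] s by simp_all
  show "cos \<theta> *\<^sub>R im_part1 g E1 E2 \<Phi> h1 h2 c t1 t2 x = sin \<theta> *\<^sub>R re_part1 g E1 E2 \<Phi> h1 h2 c t1 t2 x"
    "cos \<theta> *\<^sub>R im_part2 g E1 E2 \<Phi> h1 h2 \<sigma> c t1 t2 x = sin \<theta> *\<^sub>R re_part2 g E1 E2 \<Phi> h1 h2 \<sigma> c t1 t2 x"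
    unfolding matrix_eq_1x1[OF rank1 rank1] matrix_eq_1x1[OF rank2 rank2] vector_scaleR_component ent
    unfolding scaleR_conv_of_real of_real_mult[symmetric] eq by simp_all
  show "positive_endo (metric_matrix E1 h1 t1 x) (cos \<theta> *\<^sub>R re_part1 g E1 E2 \<Phi> h1 h2 c t1 t2 x
           + sin \<theta> *\<^sub>R im_part1 g E1 E2 \<Phi> h1 h2 c t1 t2 x)"
    "positive_endo (metric_matrix E2 h2 t2 x) (cos \<theta> *\<^sub>R re_part2 g E1 E2 \<Phi> h1 h2 \<sigma> c t1 t2 x
           + sin \<theta> *\<^sub>R im_part2 g E1 E2 \<Phi> h1 h2 \<sigma> c t1 t2 x)"
    unfolding positive_endo_entries[OF x] vector_add_component vector_scaleR_component ent
    using pos by simp_all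
qed

lemma log_N_wirtinger:
  assumes nz: "\<And>y. y \<in> U \<Longrightarrow> Phi_at y \<noteq> 0" and z: "z \<in> W"
  shows "((\<lambda>w. ln (N w)) has_derivative (\<lambda>v. 2 * Re (G z * v))) (at z)"
    and "G differentiable (at z)" and "wirt_zbar G z = K1 z - K2 z"
proof -
  have \<phi>: "\<phi> w \<noteq> 0" if "w \<in> W" for w using nz[OF chart_inv_W[OF that]] by (simp add: \<phi>_def)
  note l = log_ratio_wirtinger[OF open_W smooth_P P_pos smooth_Q Q_pos hol_\<phi> \<phi> z]
  show "((\<lambda>w. ln (N w)) has_derivative (\<lambda>v. 2 * Re (G z * v))) (at z)"
    "G differentiable (at z)" "wirt_zbar G z = K1 z - K2 z"
    using l by (simp_all add: N_def[abs_def] G_def[abs_def] K1_def K2_def)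
qed

lemma norm_Phi_pos:
  assumes "x \<in> U" "Phi_at x \<noteq> 0" shows "norm_Phi x > 0"
  using N_pos[OF in_W[OF assms(1)]] assms by (simp add: Phi_entries \<phi>_def chart_inv_U)

text \<open>The curvatures are -K1/g and -K2/g while the zbar-derivative of \<open>G\<close> is K1 -
  K2, so its sign at an extremum of log |\<Phi>|^2 compares them; \<open>G = 0\<close> there removes
  the gradient term. Extremality within the coordinate domain is enough.\<close>

lemma curvature_at_extremum:
  assumes nz: "\<And>y. y \<in> U \<Longrightarrow> Phi_at y \<noteq> 0" and x: "x \<in> U"
  shows "(\<And>y. y \<in> U \<Longrightarrow> norm_Phi y \<le> norm_Phi x) \<Longrightarrow> norm_nabla x = 0 \<and> Re (B_at x) \<le> Re (A_at x)"
    and "(\<And>y. y \<in> U \<Longrightarrow> norm_Phi x \<le> norm_Phi y) \<Longrightarrow> norm_nabla x = 0 \<and> Re (A_at x) \<le> Re (B_at x)"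
proof -
  let ?z = "snd c x"
  have Nw: "N w = norm_Phi (chart_inv c w)" "N w > 0" if "w \<in> W" for w
    using Phi_entries(2)[OF chart_inv_W[OF that]] norm_Phi_pos[OF chart_inv_W[OF that]] nz
      chart_inv_W[OF that] that by (simp_all add: snd_chart_inv_W)
  have nabla: "norm_nabla x = N ?z * (cmod (G ?z))\<^sup>2 / g c x"
    using nabla_Phi_entries(2)[OF x] nz[OF x] by (simp add: \<phi>_def chart_inv_U[OF x])
  have AB: "Re (A_at x) = - Re (K1 ?z) / g c x" "Re (B_at x) = - Re (K2 ?z) / g c x"
    by (simp_all add: i_Lambda_F_entries[OF x])
  note l = log_N_wirtinger[OF nz]
  {
    assume "\<And>y. y \<in> U \<Longrightarrow> norm_Phi y \<le> norm_Phi x"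
    then have "ln (N w) \<le> ln (N ?z)" if "w \<in> W" for w
      using Nw[OF that] Nw[OF in_W[OF x]] chart_inv_W[OF that] by (simp add: chart_inv_U[OF x])
    then have "G ?z = 0" "Re (wirt_zbar G ?z) \<le> 0"
      using wirtinger_local_max[OF open_W in_W[OF x] l(1) l(2)[OF _ in_W[OF x]]] by simp_all
    then show "norm_nabla x = 0 \<and> Re (B_at x) \<le> Re (A_at x)"
      using l(3)[OF _ in_W[OF x]] g_pos[OF x] by (simp add: nabla AB divide_right_mono)
  }
  {
    assume "\<And>y. y \<in> U \<Longrightarrow> norm_Phi x \<le> norm_Phi y"
    then have min: "- ln (N w) \<le> - ln (N ?z)" if "w \<in> W" for w
      using Nw[OF that] Nw[OF in_W[OF x]] chart_inv_W[OF that] by (simp add: chart_inv_U[OF x])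
    \<comment> \<open>The minimum is treated as a maximum of -log N; \<open>0 - G\<close> instead of
      \<open>- G\<close> matches \<open>wirt_zbar_diff\<close>.\<close>
    have d: "((\<lambda>w. - ln (N w)) has_derivative (\<lambda>v. 2 * Re ((0 - G z) * v))) (at z)" if "z \<in> W" for z
      using has_derivative_minus[OF l(1)[OF _ that]] by (simp add: algebra_simps)
    have dG: "(\<lambda>w. 0 - G w) differentiable (at ?z)"
      using l(2)[OF _ in_W[OF x]] by (intro differentiable_diff) auto
    have "wirt_zbar (\<lambda>w. 0 - G w) ?z = - wirt_zbar G ?z"
      using wirt_zbar_diff[OF _ l(2)[OF _ in_W[OF x]], of "\<lambda>_. 0"]
      by (simp add: wirt_zbar_def frechet_derivative_const)
    then have "G ?z = 0" "Re (wirt_zbar G ?z) \<ge> 0"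
      using wirtinger_local_max[OF open_W in_W[OF x] d dG min] by simp_all
    then show "norm_nabla x = 0 \<and> Re (A_at x) \<le> Re (B_at x)"
      using l(3)[OF _ in_W[OF x]] g_pos[OF x] by (simp add: nabla AB divide_right_mono)
  }
qed

lemma continuous_norm_Phi:
  assumes nz: "\<And>y. y \<in> U \<Longrightarrow> Phi_at y \<noteq> 0"
  shows "continuous_on U norm_Phi"
proof -
  have "continuous_on W (\<lambda>w. ln (N w))"
    using log_N_wirtinger(1)[OF nz] by (intro continuous_at_imp_continuous_on ballI has_derivative_continuous)
  moreover have "continuous_on U (snd c)"
    using chart_image(2)[OF surface c] by (rule continuous_on_subset) (auto simp: U_def)
  ultimately have "continuous_on U (\<lambda>y. ln (N (snd c y)))"
    by (rule continuous_on_compose2) (simp add: W_def)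
  \<comment> \<open>Continuity is inherited from the differentiable logarithm, since |\<Phi>|^2 is
    positive on \<open>U\<close>.\<close>
  then have "continuous_on U (\<lambda>y. exp (ln (N (snd c y))))"
    by (rule continuous_on_exp)
  moreover have "exp (ln (N (snd c y))) = norm_Phi y" if "y \<in> U" for y
    using norm_Phi_pos[OF that nz[OF that]] Phi_entries(2)[OF that] by simp
  ultimately show ?thesis by (metis (no_types, lifting) continuous_on_cong)
qed

end

section \<open>Global arguments\<close>

lemma surface_frame:
  assumes "riemann_surface \<A>" "hol_vector_bundle \<A> E1" "hol_vector_bundle \<A> E2"
  obtains c t1 t2 where "c \<in> \<A>" "t1 \<in> trivs E1" "t2 \<in> trivs E2" "x \<in> fst c \<inter> fst t1 \<inter> fst t2"
proof -
  have "x \<in> (\<Union>c\<in>\<A>. fst c)" "x \<in> (\<Union>t\<in>trivs E1. fst t)" "x \<in> (\<Union>t\<in>trivs E2. fst t)"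
    using assms by (simp_all add: riemann_surface_def hol_vector_bundle_def)
  then show ?thesis using that by blast
qed

text \<open>The pointwise result with \<open>A\<close> the curvature of E1, \<open>M\<close> and
  \<open>N\<close> the matrices of \<Phi> and its covariant derivative, and k = 1/g.\<close>

lemma adjoint_kernel_trivial:
  assumes kaehler: "kaehler_form \<A> g" and E: "hol_vector_bundle \<A> E1" "hol_vector_bundle \<A> E2"
    and h: "hermitian_metric \<A> E1 h1" "hermitian_metric \<A> E2 h2"
    and \<theta>: "cos \<theta> \<le> 0" "sin \<theta> > 0"
    and eq: "deformed_vortex_equations \<A> g E1 E2 \<Phi> h1 h2 \<sigma> \<theta>"
    and cal: "calibration_constraint \<A> g E1 E2 \<Phi> h1 h2 \<sigma> \<theta>"
    and x: "c \<in> \<A>" "t1 \<in> trivs E1" "t2 \<in> trivs E2" "x \<in> fst c \<inter> fst t1 \<inter> fst t2"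
    and ker: "ctranspose (hom_matrix E2 t2 t1 \<Phi> x) *v (metric_matrix E1 h1 t1 x *v v) = 0"
  shows "v = 0"
proof (rule calibrated_kernel_trivial[OF _ _ \<theta> _ _ _ ker])
  show "positive_definite (metric_matrix E1 h1 t1 x)" "positive_definite (metric_matrix E2 h2 t2 x)"
    using x by (intro metric_matrix_positive[OF E(1) h(1)] metric_matrix_positive[OF E(2) h(2)]; simp)+
  have "g c x > 0" using kaehler x unfolding kaehler_form_def by blast
  then show "1 / g c x \<ge> 0" by simp
  note unf = im_part1_def re_part1_def Phi_Phi_adj_def nabla_Phi_nabla_Phi_adj_def Let_def
  show "cos \<theta> *\<^sub>R (i_Lambda_F g E1 h1 c t1 x + hom_matrix E2 t2 t1 \<Phi> x **
      hom_adjoint (metric_matrix E1 h1 t1 x) (metric_matrix E2 h2 t2 x) (hom_matrix E2 t2 t1 \<Phi> x)) =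
    sin \<theta> *\<^sub>R (mat 1 - (1/2) *\<^sub>R anticomm (i_Lambda_F g E1 h1 c t1 x) (hom_matrix E2 t2 t1 \<Phi> x **
      hom_adjoint (metric_matrix E1 h1 t1 x) (metric_matrix E2 h2 t2 x) (hom_matrix E2 t2 t1 \<Phi> x))
      + (1/2) *\<^sub>R (1 / g c x) *\<^sub>R (nabla_Phi E1 E2 \<Phi> h1 h2 c t1 t2 x **
      hom_adjoint (metric_matrix E1 h1 t1 x) (metric_matrix E2 h2 t2 x) (nabla_Phi E1 E2 \<Phi> h1 h2 c t1 t2 x)))"
    using eq x unfolding deformed_vortex_equations_def unf by blast
  show "positive_endo (metric_matrix E1 h1 t1 x)
    (cos \<theta> *\<^sub>R (mat 1 - (1/2) *\<^sub>R anticomm (i_Lambda_F g E1 h1 c t1 x) (hom_matrix E2 t2 t1 \<Phi> x **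
      hom_adjoint (metric_matrix E1 h1 t1 x) (metric_matrix E2 h2 t2 x) (hom_matrix E2 t2 t1 \<Phi> x))
      + (1/2) *\<^sub>R (1 / g c x) *\<^sub>R (nabla_Phi E1 E2 \<Phi> h1 h2 c t1 t2 x **
      hom_adjoint (metric_matrix E1 h1 t1 x) (metric_matrix E2 h2 t2 x) (nabla_Phi E1 E2 \<Phi> h1 h2 c t1 t2 x)))
    + sin \<theta> *\<^sub>R (i_Lambda_F g E1 h1 c t1 x + hom_matrix E2 t2 t1 \<Phi> x **
      hom_adjoint (metric_matrix E1 h1 t1 x) (metric_matrix E2 h2 t2 x) (hom_matrix E2 t2 t1 \<Phi> x)))"
    using cal x unfolding calibration_constraint_def unf by blast
qed

lemma vortex_solution_rank_one:
  fixes E1 :: "('a::t2_space, 'e1, 'n::finite) vbundle" and E2 :: "('a, 'e2, 'm::finite) vbundle"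
  assumes surface: "riemann_surface \<A>" and kaehler: "kaehler_form \<A> g"
    and triple: "vortex_triple \<A> E1 E2 \<Phi>"
    and h: "hermitian_metric \<A> E1 h1" "hermitian_metric \<A> E2 h2"
    and \<theta>: "cos \<theta> \<le> 0" "sin \<theta> > 0"
    and eq: "deformed_vortex_equations \<A> g E1 E2 \<Phi> h1 h2 \<sigma> \<theta>"
    and cal: "calibration_constraint \<A> g E1 E2 \<Phi> h1 h2 \<sigma> \<theta>"
  shows "bundle_rank E1 = 1" and "nowhere_vanishing E2 E1 \<Phi>"
proof -
  have E: "hol_vector_bundle \<A> E1" "hol_vector_bundle \<A> E2"
    and rank2: "CARD('m) = 1" and sec: "hol_hom_section \<A> E2 E1 \<Phi>"
    using triple by (simp_all add: vortex_triple_def bundle_rank_def)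
  note ker = adjoint_kernel_trivial[OF kaehler E h \<theta> eq cal]
  show "bundle_rank E1 = 1"
  proof (rule ccontr)
    fix x :: 'a
    assume "bundle_rank E1 \<noteq> 1"
    then have n: "CARD('n) \<noteq> 1" by (simp add: bundle_rank_def)
    obtain c t1 t2 where x: "c \<in> \<A>" "t1 \<in> trivs E1" "t2 \<in> trivs E2" "x \<in> fst c \<inter> fst t1 \<inter> fst t2"
      using surface_frame[OF surface E] by metis
    \<comment> \<open>Up to the invertible factor from the metric of E2 this product is the adjoint
      of \<Phi>. It has a single row because E2 is a line bundle.\<close>
    obtain v where "v \<noteq> 0" "(ctranspose (hom_matrix E2 t2 t1 \<Phi> x) ** metric_matrix E1 h1 t1 x) *v v = 0"
      using exists_kernel_vector[OF rank2 n] by metis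
    then show False using ker[OF x, of v] by (simp add: matrix_vector_mul_assoc)
  qed
  show "nowhere_vanishing E2 E1 \<Phi>"
    unfolding nowhere_vanishing_def
  proof
    fix x :: 'a
    obtain c t1 t2 where x: "c \<in> \<A>" "t1 \<in> trivs E1" "t2 \<in> trivs E2" "x \<in> fst c \<inter> fst t1 \<inter> fst t2"
      using surface_frame[OF surface E] by metis
    obtain b where b: "UNIV = {b :: 'm}" using rank2 card_1_singletonE by blast
    \<comment> \<open>A generator of the fibre: if \<Phi> kills it, the matrix of \<Phi> vanishes at
      \<open>x\<close> and every vector lies in the kernel of the adjoint.\<close>
    define e where "e = lift E2 t2 x (axis b 1)"
    have e: "proj E2 e = x" "snd t2 e = axis b 1"
      using lift_in_fibre[OF E(2) x(3)] x(4) by (auto simp: e_def)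
    have "\<not> is_zero E1 (\<Phi> e)"
    proof
      assume "is_zero E1 (\<Phi> e)"
      \<comment> \<open>\<open>is_zero\<close> supplies its own trivialisation, so the argument
        continues with \<open>t\<close> in place of \<open>t1\<close>.\<close>
      then obtain t where t: "t \<in> trivs E1" "proj E1 (\<Phi> e) \<in> fst t" "snd t (\<Phi> e) = 0"
        by (auto simp: is_zero_def)
      have xt: "x \<in> fst c \<inter> fst t \<inter> fst t2"
        using t(2) sec x(4) e(1) by (simp add: hol_hom_section_def)
      have "hom_matrix E2 t2 t \<Phi> x *v axis b 1 = 0"
        using hom_matrix_apply[OF E(2) sec x(3) t(1), of e] xt e t(3) by simp
      then have z: "hom_matrix E2 t2 t \<Phi> x $ i $ b = 0" for i
        by (simp add: matrix_vector_mult_def axis_def vec_eq_iff b)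
      have "hom_matrix E2 t2 t \<Phi> x $ i $ j = 0" for i j
        using z[of i] all_singleton_UNIV[OF b, of "\<lambda>j. hom_matrix E2 t2 t \<Phi> x $ i $ j = 0"] by simp
      then have "ctranspose (hom_matrix E2 t2 t \<Phi> x) *v w = 0" for w :: "complex ^ 'n"
        by (simp add: ctranspose_def matrix_vector_mult_def vec_eq_iff)
      then have "v = 0" for v :: "complex ^ 'n"
        using ker[OF x(1) t(1) x(3) xt, of v] by simp
      from this[of "axis undefined 1"] show False by (simp add: axis_eq_0_iff)
    qed
    then show "\<exists>e. proj E2 e = x \<and> \<not> is_zero E1 (\<Phi> e)" using e by blast
  qed
qed

lemma hom_matrix_nonzero:
  fixes E1 :: "('a::t2_space, 'e1, 'n::finite) vbundle" and E2 :: "('a, 'e2, 'm::finite) vbundle"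
  assumes sec: "hol_vector_bundle \<A> E2" "hol_hom_section \<A> E2 E1 \<Phi>"
    and ranks: "UNIV = {a :: 'n}" "UNIV = {b :: 'm}"
    and nz: "nowhere_vanishing E2 E1 \<Phi>"
    and x: "t1 \<in> trivs E1" "t2 \<in> trivs E2" "x \<in> fst t1 \<inter> fst t2"
  shows "hom_matrix E2 t2 t1 \<Phi> x $ a $ b \<noteq> 0"
proof
  assume 0: "hom_matrix E2 t2 t1 \<Phi> x $ a $ b = 0"
  obtain e where e: "proj E2 e = x" "\<not> is_zero E1 (\<Phi> e)"
    using nz by (auto simp: nowhere_vanishing_def)
  have "proj E1 (\<Phi> e) = x" using sec(2) e(1) by (simp add: hol_hom_section_def)
  then have "snd t1 (\<Phi> e) \<noteq> 0" using e(2) x by (auto simp: is_zero_def)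
  moreover have "snd t1 (\<Phi> e) = hom_matrix E2 t2 t1 \<Phi> x *v snd t2 e"
    using hom_matrix_apply[OF sec x(2,1), of e] e(1) x(3) by simp
  ultimately show False
    by (simp add: vec_eq_iff all_singleton_UNIV[OF ranks(1)] matrix_vector_mult_def ranks(2) 0)
qed

text \<open>\<Phi> itself is the isomorphism: on each fibre it multiplies by a nonzero number, and
  the inverse of a holomorphic function without zeros is holomorphic.\<close>

lemma line_bundle_isomorphism:
  fixes E1 :: "('a::t2_space, 'e1, 'n::finite) vbundle" and E2 :: "('a, 'e2, 'm::finite) vbundle"
  assumes surface: "riemann_surface \<A>" and triple: "vortex_triple \<A> E1 E2 \<Phi>"
    and rank: "bundle_rank E1 = 1" and nz: "nowhere_vanishing E2 E1 \<Phi>"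
  shows "hol_isomorphic \<A> E2 E1"
proof -
  have E: "hol_vector_bundle \<A> E1" "hol_vector_bundle \<A> E2"
    and r: "CARD('m) = 1" "CARD('n) = 1" and sec: "hol_hom_section \<A> E2 E1 \<Phi>"
    using triple rank by (simp_all add: vortex_triple_def bundle_rank_def)
  obtain a where a: "UNIV = {a :: 'n}" using r card_1_singletonE by blast
  obtain b where b: "UNIV = {b :: 'm}" using r card_1_singletonE by blast
  let ?M = "\<lambda>t1 t2 x. hom_matrix E2 t2 t1 \<Phi> x $ a $ b"
  have M: "?M t1 t2 x \<noteq> 0" if "t1 \<in> trivs E1" "t2 \<in> trivs E2" "x \<in> fst t1 \<inter> fst t2" for t1 t2 x
    using hom_matrix_nonzero[OF E(2) sec a b nz that] .
  have proj: "proj E1 (\<Phi> e) = proj E2 e" for e using sec by (simp add: hol_hom_section_def)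
  have app: "snd t1 (\<Phi> e) $ a = ?M t1 t2 (proj E2 e) * snd t2 e $ b"
    if "t1 \<in> trivs E1" "t2 \<in> trivs E2" "proj E2 e \<in> fst t1 \<inter> fst t2" for t1 t2 e
    using hom_matrix_apply[OF E(2) sec that(2,1), of e] that(3) by (simp add: matrix_vector_mult_def b)
  have eq_a: "v = w \<longleftrightarrow> v $ a = w $ a" for v w :: "complex ^ 'n"
    by (simp add: vec_eq_iff all_singleton_UNIV[OF a])
  have eq_b: "v = w \<longleftrightarrow> v $ b = w $ b" for v w :: "complex ^ 'm"
    by (simp add: vec_eq_iff all_singleton_UNIV[OF b])
  have inj: "inj \<Phi>"
  proof (rule injI)
    fix e e' assume ee: "\<Phi> e = \<Phi> e'"
    then have p: "proj E2 e' = proj E2 e" using proj by metis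
    obtain c t1 t2 where "c \<in> \<A>" and x: "t1 \<in> trivs E1" "t2 \<in> trivs E2" "proj E2 e \<in> fst c \<inter> fst t1 \<inter> fst t2"
      using surface_frame[OF surface E] by metis
    have "snd t2 e $ b = snd t2 e' $ b"
      using app[OF x(1,2), of e] app[OF x(1,2), of e'] M[OF x(1,2), of "proj E2 e"] x(3) ee p by simp
    then have "snd t2 e = snd t2 e'" by (simp add: eq_b)
    moreover have "inj_on (snd t2) (proj E2 -` {proj E2 e})"
      using E(2) x(2,3) unfolding hol_vector_bundle_def bij_betw_def by blast
    ultimately show "e = e'" using p by (auto simp: inj_on_def)
  qed
  have surj: "\<exists>e. \<Phi> e = e1" for e1
  proof -
    obtain c t1 t2 where "c \<in> \<A>" and x: "t1 \<in> trivs E1" "t2 \<in> trivs E2" "proj E1 e1 \<in> fst c \<inter> fst t1 \<inter> fst t2"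
      using surface_frame[OF surface E] by metis
    \<comment> \<open>The preimage is found by dividing the fibre coordinate by the entry of
      \<Phi>.\<close>
    define e where "e = lift E2 t2 (proj E1 e1) (\<chi> i. snd t1 e1 $ a / ?M t1 t2 (proj E1 e1))"
    have e: "proj E2 e = proj E1 e1" "snd t2 e $ b = snd t1 e1 $ a / ?M t1 t2 (proj E1 e1)"
      using lift_in_fibre[OF E(2) x(2), of "proj E1 e1"] x(3) by (simp_all add: e_def)
    have "snd t1 (\<Phi> e) = snd t1 e1"
      using app[OF x(1,2), of e] M[OF x(1,2), of "proj E1 e1"] x(3) e by (simp add: eq_a)
    moreover have "inj_on (snd t1) (proj E1 -` {proj E1 e1})"
      using E(1) x(1,3) unfolding hol_vector_bundle_def bij_betw_def by blast
    ultimately have "\<Phi> e = e1" using proj[of e] e(1) by (auto simp: inj_on_def)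
    then show ?thesis by blast
  qed
  have inv: "\<Phi> (inv \<Phi> e) = e" for e using surj by (metis f_inv_into_f rangeI)
  have "hol_hom_section \<A> E1 E2 (inv \<Phi>)"
    unfolding hol_hom_section_def
  proof (intro conjI allI ballI)
    show "proj E2 (inv \<Phi> e) = proj E1 e" for e using proj[of "inv \<Phi> e"] by (simp add: inv)
    fix t1 t2 assume t: "t1 \<in> trivs E1" "t2 \<in> trivs E2"
    let ?R = "\<lambda>x. (\<chi> i j. inverse (?M t1 t2 x)) :: complex ^ 'n ^ 'm"
    have "(\<lambda>z. ?M t1 t2 (chart_inv c z)) holomorphic_on snd c ` (fst c \<inter> (fst t1 \<inter> fst t2))"
      if "c \<in> \<A>" for c
      using hom_matrix_holomorphic[OF surface that E(2) sec t(2,1)] by (simp add: Int_commute)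
    moreover have "?M t1 t2 (chart_inv c z) \<noteq> 0"
      if "c \<in> \<A>" "z \<in> snd c ` (fst c \<inter> (fst t1 \<inter> fst t2))" for c z
      using that(2) chart_image(3)[OF surface that(1)] by (intro M t) auto
    ultimately have "hol_matrix_on_surface \<A> ?R (fst t1 \<inter> fst t2)"
      by (auto simp: hol_matrix_on_surface_def hol_on_surface_def o_def intro!: holomorphic_on_inverse)
    moreover have "snd t2 (inv \<Phi> e) = ?R (proj E1 e) *v snd t1 e" if "proj E1 e \<in> fst t1 \<inter> fst t2" for e
      using app[OF t, of "inv \<Phi> e"] M[OF t that] proj[of "inv \<Phi> e"] that
      by (simp add: eq_b inv matrix_vector_mult_def a field_simps)
    ultimately show "\<exists>M. hol_matrix_on_surface \<A> M (fst t1 \<inter> fst t2) \<and>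
        (\<forall>e. proj E1 e \<in> fst t1 \<inter> fst t2 \<longrightarrow> snd t2 (inv \<Phi> e) = M (proj E1 e) *v snd t1 e)"
      by blast
  qed
  moreover have "inv \<Phi> \<circ> \<Phi> = id" "\<Phi> \<circ> inv \<Phi> = id"
    using inj inv by (auto simp: fun_eq_iff)
  ultimately show ?thesis using sec unfolding hol_isomorphic_def by blast
qed

text \<open>Glues the frame expressions to one continuous function on the surface, the object to
  which compactness can be applied. Independence of the frame comes from
  \<open>norm_quotient\<close>.\<close>

lemma norm2_Phi_function:
  fixes E1 :: "('a::t2_space, 'e1, 'n::finite) vbundle" and E2 :: "('a, 'e2, 'm::finite) vbundle"
  assumes frame: "\<And>c t1 t2. c \<in> \<A> \<Longrightarrow> t1 \<in> trivs E1 \<Longrightarrow> t2 \<in> trivs E2 \<Longrightarrow>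
      line_frame \<A> g E1 E2 \<Phi> h1 h2 a b c t1 t2"
    and surface: "riemann_surface \<A>" and E: "hol_vector_bundle \<A> E1" "hol_vector_bundle \<A> E2"
    and nz: "\<And>t1 t2 x. t1 \<in> trivs E1 \<Longrightarrow> t2 \<in> trivs E2 \<Longrightarrow> x \<in> fst t1 \<inter> fst t2 \<Longrightarrow>
      hom_matrix E2 t2 t1 \<Phi> x $ a $ b \<noteq> 0"
  obtains F where "continuous_on UNIV F"
    "\<And>t1 t2 x. t1 \<in> trivs E1 \<Longrightarrow> t2 \<in> trivs E2 \<Longrightarrow> x \<in> fst t1 \<inter> fst t2 \<Longrightarrow>
      norm2_Phi E1 E2 \<Phi> h1 h2 t1 t2 x = F x"
proof -
  define n where "n = norm2_Phi E1 E2 \<Phi> h1 h2"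
  have quot: "Re (h1 (\<Phi> e) (\<Phi> e)) = n t1 t2 (proj E2 e) * Re (h2 e e)"
    if t: "t1 \<in> trivs E1" "t2 \<in> trivs E2" "proj E2 e \<in> fst t1 \<inter> fst t2" for t1 t2 e
  proof -
    obtain c where "c \<in> \<A>" and x: "proj E2 e \<in> fst c"
      using surface unfolding riemann_surface_def by blast
    then interpret line_frame \<A> g E1 E2 \<Phi> h1 h2 a b c t1 t2 using frame t by blast
    show ?thesis using norm_quotient[of e] Phi_entries(2)[of "proj E2 e"] x t(3) by (simp add: U_def n_def)
  qed
  have indep: "n t1 t2 x = n t1' t2' x"
    if t: "t1 \<in> trivs E1" "t2 \<in> trivs E2" "x \<in> fst t1 \<inter> fst t2"
      "t1' \<in> trivs E1" "t2' \<in> trivs E2" "x \<in> fst t1' \<inter> fst t2'" for t1 t2 t1' t2' x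
  proof -
    obtain c where c: "c \<in> \<A>" "x \<in> fst c"
      using surface unfolding riemann_surface_def by blast
    interpret line_frame \<A> g E1 E2 \<Phi> h1 h2 a b c t1 t2 using frame c t by blast
    define e where "e = lift E2 t2 x (axis b 1)"
    have e: "proj E2 e = x" "snd t2 e = axis b 1"
      using lift_in_fibre[OF E(2) t(2)] t(3) by (auto simp: e_def)
    \<comment> \<open>A vector of positive length, so that it may be cancelled from two instances of
      \<open>quot\<close>.\<close>
    have "h2 e e = hdot (metric_matrix E2 h2 t2 x *v axis b 1) (axis b 1)"
      using metric_matrix_inner[OF E(2) metric2 t(2), of e e] e t(3) by simp
    also have "Re \<dots> > 0"
      using metric_matrix_positive[OF E(2) metric2 t(2), of x] t(3)
      by (simp add: positive_definite_def axis_eq_0_iff)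
    finally have "Re (h2 e e) > 0" .
    then show ?thesis using quot[OF t(1,2), of e] quot[OF t(4,5), of e] t(3,6) by (simp add: e)
  qed
  define F where "F x = (SOME r. \<exists>t1\<in>trivs E1. \<exists>t2\<in>trivs E2. x \<in> fst t1 \<inter> fst t2 \<and> r = n t1 t2 x)" for x
  have F: "n t1 t2 x = F x" if "t1 \<in> trivs E1" "t2 \<in> trivs E2" "x \<in> fst t1 \<inter> fst t2" for t1 t2 x
  proof -
    have "\<exists>t1'\<in>trivs E1. \<exists>t2'\<in>trivs E2. x \<in> fst t1' \<inter> fst t2' \<and> F x = n t1' t2' x"
      unfolding F_def by (rule someI_ex) (use that in blast)
    then show ?thesis using indep[OF that] by metis
  qed
  have "isCont F x" for x
  proof -
    obtain c t1 t2 where x: "c \<in> \<A>" "t1 \<in> trivs E1" "t2 \<in> trivs E2" "x \<in> fst c \<inter> fst t1 \<inter> fst t2"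
      using surface_frame[OF surface E] by metis
    interpret line_frame \<A> g E1 E2 \<Phi> h1 h2 a b c t1 t2 using frame x by blast
    have "continuous_on U (n t1 t2)"
      unfolding n_def using nz[OF t1 t2] by (intro continuous_norm_Phi) (auto simp: U_def)
    moreover have "n t1 t2 y = F y" if "y \<in> U" for y
      using that by (intro F t1 t2) (auto simp: U_def)
    ultimately have "continuous_on U F" by (metis (no_types, lifting) continuous_on_cong)
    then show ?thesis using open_U x(4) by (simp add: continuous_on_eq_continuous_at U_def)
  qed
  then have "continuous_on UNIV F" by (simp add: continuous_on_eq_continuous_at)
  with F that show ?thesis unfolding n_def by blast
qed

text \<open>The isomorphism of the bundles is a separate conjunct because it is a consequence of
  (ii), not a further condition in the equivalence.\<close>

theorem proposition3p10:
  fixes \<A> :: "('a::t2_space) chart set"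
    and g :: "'a chart \<Rightarrow> 'a \<Rightarrow> real"
    and E1 :: "('a, 'e1, 'n::finite) vbundle"
    and E2 :: "('a, 'e2, 'm::finite) vbundle"
    and \<Phi> :: "'e2 \<Rightarrow> 'e1"
    and h1 :: "'e1 \<Rightarrow> 'e1 \<Rightarrow> complex"
    and h2 :: "'e2 \<Rightarrow> 'e2 \<Rightarrow> complex"
    and \<sigma> \<theta> :: real
  assumes "riemann_surface \<A>" and "compact (UNIV :: 'a set)" and "connected (UNIV :: 'a set)"
    and "kaehler_form \<A> g"
    and "vortex_triple \<A> E1 E2 \<Phi>"
    and "\<sigma> > 0"
    and "Im (central_charge \<A> g E1 E2 \<sigma>) > 0"
    and "\<theta> = Arg (central_charge \<A> g E1 E2 \<sigma>)"
    and "cos \<theta> \<le> 0"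
    and "hermitian_metric \<A> E1 h1" and "hermitian_metric \<A> E2 h2"
  shows "(deformed_vortex_equations \<A> g E1 E2 \<Phi> h1 h2 \<sigma> \<theta> \<and>
          calibration_constraint \<A> g E1 E2 \<Phi> h1 h2 \<sigma> \<theta>
         \<longleftrightarrow>
          cos \<theta> + 2 * pi / \<sigma> * sin \<theta> > 0 \<and>
          (bundle_rank E1 = 1 \<and> nowhere_vanishing E2 E1 \<Phi>) \<and>
          (let f = (sin \<theta> - 2 * pi / \<sigma> * cos \<theta>) / (cos \<theta> + 2 * pi / \<sigma> * sin \<theta>) in
             constant_i_Lambda_F \<A> g E1 h1 f \<and> constant_i_Lambda_F \<A> g E2 h2 f \<and>
             constant_norm2_Phi E1 E2 \<Phi> h1 h2 (2 * pi / \<sigma>)))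
       \<and> (bundle_rank E1 = 1 \<and> nowhere_vanishing E2 E1 \<Phi> \<longrightarrow> hol_isomorphic \<A> E2 E1)"
proof (intro conjI impI)
  note surface = assms(1) and kaehler = assms(4) and triple = assms(5) and h = assms(10,11)
  have E: "hol_vector_bundle \<A> E1" "hol_vector_bundle \<A> E2"
    and rank2: "CARD('m) = 1" and sec: "hol_hom_section \<A> E2 E1 \<Phi>"
    using triple by (simp_all add: vortex_triple_def bundle_rank_def)
  let ?Z = "central_charge \<A> g E1 E2 \<sigma>"
  \<comment> \<open>Polar form: the hypothesis on the imaginary part becomes positivity of
    \<open>sin \<theta>\<close>.\<close>
  have "Im ?Z = cmod ?Z * sin \<theta>"
    by (metis Im_rcis assms(8) rcis_cmod_Arg)
  then have s: "sin \<theta> > 0"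
    using assms(7) by (simp add: zero_less_mult_iff)
  have cs: "(cos \<theta>)\<^sup>2 + (sin \<theta>)\<^sup>2 = 1" by simp
  define y where "y = 2 * pi / \<sigma>"
  have y: "4 * pi / \<sigma> = 2 * y" by (simp add: y_def)
  obtain b where b: "UNIV = {b :: 'm}" using rank2 card_1_singletonE by blast
  show "hol_isomorphic \<A> E2 E1" if "bundle_rank E1 = 1 \<and> nowhere_vanishing E2 E1 \<Phi>"
    using line_bundle_isomorphism[OF surface triple] that by blast
  define f where "f = (sin \<theta> - 2 * pi / \<sigma> * cos \<theta>) / (cos \<theta> + 2 * pi / \<sigma> * sin \<theta>)"
  have "deformed_vortex_equations \<A> g E1 E2 \<Phi> h1 h2 \<sigma> \<theta> \<and>
          calibration_constraint \<A> g E1 E2 \<Phi> h1 h2 \<sigma> \<theta>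
      \<longleftrightarrow> cos \<theta> + 2 * pi / \<sigma> * sin \<theta> > 0 \<and>
          (bundle_rank E1 = 1 \<and> nowhere_vanishing E2 E1 \<Phi>) \<and>
          constant_i_Lambda_F \<A> g E1 h1 f \<and> constant_i_Lambda_F \<A> g E2 h2 f \<and>
             constant_norm2_Phi E1 E2 \<Phi> h1 h2 (2 * pi / \<sigma>)" (is "?eqs \<longleftrightarrow> ?sol")
  proof (cases "bundle_rank E1 = 1 \<and> nowhere_vanishing E2 E1 \<Phi>")
    \<comment> \<open>Here both sides fail: the right one contains the negated condition, the left
      one implies it.\<close>
    case False
    then show ?thesis
      using vortex_solution_rank_one[OF surface kaehler triple h assms(9) s] by blast
  next
    case True
    then have "CARD('n) = 1" by (simp add: bundle_rank_def)
    then obtain a where a: "UNIV = {a :: 'n}" using card_1_singletonE by blast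
    have frame: "line_frame \<A> g E1 E2 \<Phi> h1 h2 a b c t1 t2"
      if "c \<in> \<A>" "t1 \<in> trivs E1" "t2 \<in> trivs E2" for c t1 t2
      by (unfold_locales) (fact surface kaehler triple h a b that)+
    have nz: "hom_matrix E2 t2 t1 \<Phi> x $ a $ b \<noteq> 0"
      if "t1 \<in> trivs E1" "t2 \<in> trivs E2" "x \<in> fst t1 \<inter> fst t2" for t1 t2 x
      using hom_matrix_nonzero[OF E(2) sec a b _ that] True by blast
    obtain F where F_cont: "continuous_on UNIV F" and
      F: "\<And>t1 t2 x. t1 \<in> trivs E1 \<Longrightarrow> t2 \<in> trivs E2 \<Longrightarrow> x \<in> fst t1 \<inter> fst t2 \<Longrightarrow>
        norm2_Phi E1 E2 \<Phi> h1 h2 t1 t2 x = F x"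
      by (rule norm2_Phi_function[OF frame surface E nz]) blast+
    show ?thesis
    proof
      assume ?eqs
      then have eqs: "deformed_vortex_equations \<A> g E1 E2 \<Phi> h1 h2 \<sigma> \<theta>"
        "calibration_constraint \<A> g E1 E2 \<Phi> h1 h2 \<sigma> \<theta>" by blast+
      \<comment> \<open>Both arguments of k stay where its denominator is positive, as the
        comparison at the extrema requires.\<close>
      have dom: "cos \<theta> + sin \<theta> * F x > 0" "cos \<theta> + sin \<theta> * (2 * y - F x) > 0" for x
      proof -
        obtain c t1 t2 where x: "c \<in> \<A>" "t1 \<in> trivs E1" "t2 \<in> trivs E2" "x \<in> fst c \<inter> fst t1 \<inter> fst t2"
          using surface_frame[OF surface E] by metis
        interpret line_frame \<A> g E1 E2 \<Phi> h1 h2 a b c t1 t2 using frame x by blast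
        have x: "x \<in> U" "Phi_at x \<noteq> 0" "norm_Phi x = F x"
          using x nz[OF t1 t2, of x] F[OF t1 t2, of x] by (auto simp: U_def)
        then show "cos \<theta> + sin \<theta> * F x > 0" "cos \<theta> + sin \<theta> * (2 * y - F x) > 0"
          using vortex_scalars(2,5)[OF x(1,2) s eqs] by (simp_all add: y)
      qed
      have max: "F x \<le> y" if max: "\<And>z. F z \<le> F x" for x
      proof -
        obtain c t1 t2 where x: "c \<in> \<A>" "t1 \<in> trivs E1" "t2 \<in> trivs E2" "x \<in> fst c \<inter> fst t1 \<inter> fst t2"
          using surface_frame[OF surface E] by metis
        interpret line_frame \<A> g E1 E2 \<Phi> h1 h2 a b c t1 t2 using frame x by blast
        have U: "Phi_at z \<noteq> 0" "norm_Phi z = F z" if "z \<in> U" for z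
          using that nz[OF t1 t2, of z] F[OF t1 t2, of z] by (auto simp: U_def)
        have xU: "x \<in> U" using x by (simp add: U_def)
        have "norm_nabla x = 0" "Re (B_at x) \<le> Re (A_at x)"
          using curvature_at_extremum(1)[OF U(1) xU] max U(2) xU by simp_all
        then have "F x \<le> 2 * y - F x"
          using cotangent_antimono[OF cs dom[of x], of "Re (A_at x)" "Re (B_at x)"]
            vortex_scalars(3,6)[OF xU U(1)[OF xU] s eqs] U(2)[OF xU] by (simp add: y)
        then show ?thesis by simp
      qed
      have min: "y \<le> F x" if min: "\<And>z. F x \<le> F z" for x
      proof -
        obtain c t1 t2 where x: "c \<in> \<A>" "t1 \<in> trivs E1" "t2 \<in> trivs E2" "x \<in> fst c \<inter> fst t1 \<inter> fst t2"
          using surface_frame[OF surface E] by metis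
        interpret line_frame \<A> g E1 E2 \<Phi> h1 h2 a b c t1 t2 using frame x by blast
        have U: "Phi_at z \<noteq> 0" "norm_Phi z = F z" if "z \<in> U" for z
          using that nz[OF t1 t2, of z] F[OF t1 t2, of z] by (auto simp: U_def)
        have xU: "x \<in> U" using x by (simp add: U_def)
        have "norm_nabla x = 0" "Re (A_at x) \<le> Re (B_at x)"
          using curvature_at_extremum(2)[OF U(1) xU] min U(2) xU by simp_all
        then have "2 * y - F x \<le> F x"
          using cotangent_antimono[OF cs dom(2,1)[of x], of "Re (B_at x)" "Re (A_at x)"]
            vortex_scalars(3,6)[OF xU U(1)[OF xU] s eqs] U(2)[OF xU] by (simp add: y)
        then show ?thesis by simp
      qed
      obtain x1 x2 where "\<And>z. F z \<le> F x1" "\<And>z. F x2 \<le> F z"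
        using continuous_attains_sup[OF assms(2) _ F_cont] continuous_attains_inf[OF assms(2) _ F_cont] by auto
      then have Fy: "F x = y" for x
        using max[of x1] min[of x2] by (meson order.antisym order.trans)
      have i: "cos \<theta> + sin \<theta> * y > 0" using dom(1) Fy by simp
      have curv: "i_Lambda_F g E1 h1 c t1 x = f *\<^sub>R mat 1 \<and> i_Lambda_F g E2 h2 c t2 x = f *\<^sub>R mat 1"
        if x: "c \<in> \<A>" "t1 \<in> trivs E1" "t2 \<in> trivs E2" "x \<in> fst c \<inter> fst t1 \<inter> fst t2" for c t1 t2 x
      proof -
        interpret line_frame \<A> g E1 E2 \<Phi> h1 h2 a b c t1 t2 using frame x by blast
        have U: "Phi_at z \<noteq> 0" "norm_Phi z = y" if "z \<in> U" for z
          using that nz[OF t1 t2, of z] F[OF t1 t2, of z] by (auto simp: U_def Fy)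
        have xU: "x \<in> U" using x by (simp add: U_def)
        have n: "norm_nabla x = 0"
          using curvature_at_extremum(1)[OF U(1) xU] U(2) xU by simp
        note v = vortex_scalars[OF xU U(1)[OF xU] s eqs]
        have "4 * pi / \<sigma> - norm_Phi x = y" by (simp add: y U(2)[OF xU])
        then have "Re (A_at x) * (cos \<theta> + sin \<theta> * y) = sin \<theta> - cos \<theta> * y"
          "Re (B_at x) * (cos \<theta> + sin \<theta> * y) = sin \<theta> - cos \<theta> * y"
          using v(3,6) by (simp_all add: n U(2)[OF xU])
        moreover have "f = (sin \<theta> - cos \<theta> * y) / (cos \<theta> + sin \<theta> * y)"
          by (simp add: f_def y_def mult.commute)
        ultimately have "Re (A_at x) = f" "Re (B_at x) = f"
          using i by (metis less_irrefl nonzero_eq_divide_eq)+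
        then have "A_at x = of_real f" "B_at x = of_real f"
          using v(1,4) by (simp_all add: complex_eq_iff)
        then show ?thesis
          unfolding matrix_eq_1x1[OF a a] matrix_eq_1x1[OF b b]
          by (simp add: mat_def) (simp add: scaleR_conv_of_real)
      qed
      have "constant_i_Lambda_F \<A> g E1 h1 f"
        unfolding constant_i_Lambda_F_def
      proof (intro ballI)
        fix c t1 x assume x: "c \<in> \<A>" "t1 \<in> trivs E1" "x \<in> fst c \<inter> fst t1"
        obtain t2 where "t2 \<in> trivs E2" "x \<in> fst t2" using surface_frame[OF surface E] by (metis IntD2)
        then show "i_Lambda_F g E1 h1 c t1 x = f *\<^sub>R mat 1" using curv x by blast
      qed
      moreover have "constant_i_Lambda_F \<A> g E2 h2 f"
        unfolding constant_i_Lambda_F_def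
      proof (intro ballI)
        fix c t2 x assume x: "c \<in> \<A>" "t2 \<in> trivs E2" "x \<in> fst c \<inter> fst t2"
        obtain t1 where "t1 \<in> trivs E1" "x \<in> fst t1" using surface_frame[OF surface E] by (metis IntD1 IntD2)
        then show "i_Lambda_F g E2 h2 c t2 x = f *\<^sub>R mat 1" using curv x by blast
      qed
      moreover have "constant_norm2_Phi E1 E2 \<Phi> h1 h2 (2 * pi / \<sigma>)"
        using F Fy by (simp add: constant_norm2_Phi_def y_def)
      ultimately show ?sol using True i by (simp add: y_def mult.commute)
    next
      assume ?sol
      have "(cos \<theta> *\<^sub>R im_part1 g E1 E2 \<Phi> h1 h2 c t1 t2 x = sin \<theta> *\<^sub>R re_part1 g E1 E2 \<Phi> h1 h2 c t1 t2 x \<and>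
        cos \<theta> *\<^sub>R im_part2 g E1 E2 \<Phi> h1 h2 \<sigma> c t1 t2 x = sin \<theta> *\<^sub>R re_part2 g E1 E2 \<Phi> h1 h2 \<sigma> c t1 t2 x) \<and>
        positive_endo (metric_matrix E1 h1 t1 x) (cos \<theta> *\<^sub>R re_part1 g E1 E2 \<Phi> h1 h2 c t1 t2 x
           + sin \<theta> *\<^sub>R im_part1 g E1 E2 \<Phi> h1 h2 c t1 t2 x) \<and>
        positive_endo (metric_matrix E2 h2 t2 x) (cos \<theta> *\<^sub>R re_part2 g E1 E2 \<Phi> h1 h2 \<sigma> c t1 t2 x
           + sin \<theta> *\<^sub>R im_part2 g E1 E2 \<Phi> h1 h2 \<sigma> c t1 t2 x)"
        if x: "c \<in> \<A>" "t1 \<in> trivs E1" "t2 \<in> trivs E2" "x \<in> fst c \<inter> fst t1 \<inter> fst t2" for c t1 t2 x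
      proof -
        interpret line_frame \<A> g E1 E2 \<Phi> h1 h2 a b c t1 t2 using frame x by blast
        have U: "Phi_at z \<noteq> 0" "norm_Phi z = 2 * pi / \<sigma>" if "z \<in> U" for z
          using that nz[OF t1 t2, of z] \<open>?sol\<close> t1 t2 unfolding constant_norm2_Phi_def U_def by blast+
        have xU: "x \<in> U" using x by (simp add: U_def)
        have n: "norm_nabla x = 0"
          using curvature_at_extremum(1)[OF U(1) xU] U(2) xU by simp
        have "i_Lambda_F g E1 h1 c t1 x = f *\<^sub>R mat 1" "i_Lambda_F g E2 h2 c t2 x = f *\<^sub>R mat 1"
          using \<open>?sol\<close> x unfolding constant_i_Lambda_F_def by blast+
        then have "A_at x = f *\<^sub>R 1" "B_at x = f *\<^sub>R 1" by (simp_all add: mat_def)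
        then have AB: "A_at x = of_real f" "B_at x = of_real f" by (simp_all add: scaleR_conv_of_real)
        have "cos \<theta> + 2 * pi / \<sigma> * sin \<theta> > 0" using \<open>?sol\<close> by blast
        from constant_solution_at[OF xU U(1)[OF xU] s this f_def AB U(2)[OF xU] n]
        show ?thesis by blast
      qed
      then show ?eqs
        unfolding deformed_vortex_equations_def calibration_constraint_def by blast
    qed
  qed
  then show "deformed_vortex_equations \<A> g E1 E2 \<Phi> h1 h2 \<sigma> \<theta> \<and>
          calibration_constraint \<A> g E1 E2 \<Phi> h1 h2 \<sigma> \<theta>
         \<longleftrightarrow>
          cos \<theta> + 2 * pi / \<sigma> * sin \<theta> > 0 \<and>
          (bundle_rank E1 = 1 \<and> nowhere_vanishing E2 E1 \<Phi>) \<and>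
          (let f = (sin \<theta> - 2 * pi / \<sigma> * cos \<theta>) / (cos \<theta> + 2 * pi / \<sigma> * sin \<theta>) in
             constant_i_Lambda_F \<A> g E1 h1 f \<and> constant_i_Lambda_F \<A> g E2 h2 f \<and>
             constant_norm2_Phi E1 E2 \<Phi> h1 h2 (2 * pi / \<sigma>))"
    by (simp only: Let_def f_def)
qed

end
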